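(* Let $(f_n)$ be a family of polynomials in $\mathsf{VP}^0$, with $d_n=\deg(f_n)$. Then $(f_n)$ can be computed by a family $(\Gamma_n)$ of depth four circuits with $n^{O(\log d_n)}$ addition gates and $n^{O(\sqrt{d_n}\log d_n)}$ multiplication gates. The family $(f_n)$ can also be computed by a family $(F_n)$ of depth four arithmetic formulas of size $n^{O(\sqrt{d_n}\log d_n)}$. The inputs of $\Gamma_n$ and $F_n$ are variables of $f_n$ or integers of bit size polynomial in $n$, and their multiplication gates have fan-in at most $\sqrt{3d_n}+1$.
   Context: A constant-free arithmetic circuit has input gates labelled by variables or constants from $\{-1,0,1\}$, and addition and multiplication gates; its size is its number of gates. Formal degree: 1 for inputs, maximum of inputs' formal degrees for addition gates, sum for multiplication gates; the circuit's formal degree is that of its output. A family $(f_n)$ of integer polynomials belongs to $\mathsf{VP}^0$ if there is a polynomial $p$ and constant-free circuits $C_n$ with unweighted addition gates and multiplication gates such that $C_n$ computes $f_n$ and has size and formal degree at most $p(n)$. A depth four circuit is a $\Sigma\Pi\Sigma\Pi$ circuit with gates of unbounded fan-in (output addition gate, then multiplication gates, then addition gates, then multiplication gates fed by input gates). A depth four formula is a depth four circuit where every non-output gate has fan-out one.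
   Formalization: The exponents O(log d_n) and O(√d_n log d_n) are read as O(max(1,·)), since for d_n ≤ 1 they are undefined or zero and the bounds fail (any depth four circuit has two addition and two multiplication gates); gates of constant-free circuits have fan-in two. *)

theory Defs
  imports
    "HOL-Library.Poly_Mapping"
    "HOL-Library.Log_Nat"
    "HOL-Library.Landau_Symbols"
    "HOL-Computational_Algebra.Polynomial"
begin

section \<open>Multivariate integer polynomials\<close>

text \<open>Finitely supported maps from monomials (exponent vectors) to coefficients; the
  multiplication of \<^typ>\<open>'a \<Rightarrow>\<^sub>0 'b\<close> is convolution, hence the product of polynomials.\<close>

type_synonym 'v ipoly = "('v \<Rightarrow>\<^sub>0 nat) \<Rightarrow>\<^sub>0 int"

definition var_poly :: "'v \<Rightarrow> 'v ipoly" where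
  "var_poly v = Poly_Mapping.single (Poly_Mapping.single v 1) 1"

definition const_poly :: "int \<Rightarrow> 'v ipoly" where
  "const_poly c = Poly_Mapping.single 0 c"

definition vars :: "'v ipoly \<Rightarrow> 'v set" where
  "vars f = (\<Union>m\<in>Poly_Mapping.keys f. Poly_Mapping.keys m)"

definition monom_degree :: "('v \<Rightarrow>\<^sub>0 nat) \<Rightarrow> nat" where
  "monom_degree m = (\<Sum>v\<in>Poly_Mapping.keys m. Poly_Mapping.lookup m v)"

text \<open>The zero polynomial gets degree 0.\<close>

definition total_degree :: "'v ipoly \<Rightarrow> nat" where
  "total_degree f = Max (insert 0 (monom_degree ` Poly_Mapping.keys f))"

section \<open>Arithmetic circuits\<close>

text \<open>A circuit is the list of its gates in a topological order, the output gate being last.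
  Arithmetic gates carry the list of the positions of their inputs; repeated entries are
  parallel wires.\<close>

datatype 'v gate = Var 'v | Const int | Add "nat list" | Mul "nat list"

type_synonym 'v circuit = "'v gate list"

fun gate_args :: "'v gate \<Rightarrow> nat list" where
  "gate_args (Var v) = []"
| "gate_args (Const c) = []"
| "gate_args (Add js) = js"
| "gate_args (Mul js) = js"

fun is_input :: "'v gate \<Rightarrow> bool" where
  "is_input (Var v) = True"
| "is_input (Const c) = True"
| "is_input (Add js) = False"
| "is_input (Mul js) = False"

fun is_add :: "'v gate \<Rightarrow> bool" where
  "is_add (Add js) = True"
| "is_add _ = False"

fun is_mul :: "'v gate \<Rightarrow> bool" where
  "is_mul (Mul js) = True"
| "is_mul _ = False"

definition is_circuit :: "'v circuit \<Rightarrow> bool" where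
  "is_circuit C \<longleftrightarrow> C \<noteq> [] \<and>
     (\<forall>i<length C. (\<forall>j\<in>set (gate_args (C ! i)). j < i) \<and>
        (\<not> is_input (C ! i) \<longrightarrow> gate_args (C ! i) \<noteq> []))"

text \<open>Bottom-up evaluation: the first argument of \<open>step\<close> lists the values of all
  preceding gates.\<close>

definition gate_values :: "('a list \<Rightarrow> 'v gate \<Rightarrow> 'a) \<Rightarrow> 'v circuit \<Rightarrow> 'a list" where
  "gate_values step C = foldl (\<lambda>vs g. vs @ [step vs g]) [] C"

fun poly_step :: "'v ipoly list \<Rightarrow> 'v gate \<Rightarrow> 'v ipoly" where
  "poly_step vs (Var v) = var_poly v"
| "poly_step vs (Const c) = const_poly c"
| "poly_step vs (Add js) = sum_list (map (\<lambda>j. vs ! j) js)"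
| "poly_step vs (Mul js) = prod_list (map (\<lambda>j. vs ! j) js)"

definition circuit_poly :: "'v circuit \<Rightarrow> 'v ipoly" where
  "circuit_poly C = last (gate_values poly_step C)"

fun degree_step :: "nat list \<Rightarrow> 'v gate \<Rightarrow> nat" where
  "degree_step ds (Var v) = 1"
| "degree_step ds (Const c) = 1"
| "degree_step ds (Add js) = Max (set (map (\<lambda>j. ds ! j) js))"
| "degree_step ds (Mul js) = sum_list (map (\<lambda>j. ds ! j) js)"

definition formal_degree :: "'v circuit \<Rightarrow> nat" where
  "formal_degree C = last (gate_values degree_step C)"

definition circuit_size :: "'v circuit \<Rightarrow> nat" where
  "circuit_size C = length C"

definition num_add_gates :: "'v circuit \<Rightarrow> nat" where
  "num_add_gates C = length (filter is_add C)"

definition num_mul_gates :: "'v circuit \<Rightarrow> nat" where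
  "num_mul_gates C = length (filter is_mul C)"

section \<open>Constant-free circuits and the class VP0\<close>

text \<open>Arithmetic gates of constant-free circuits have fan-in two.\<close>

definition constant_free :: "'v circuit \<Rightarrow> bool" where
  "constant_free C \<longleftrightarrow> is_circuit C \<and>
     (\<forall>c. Const c \<in> set C \<longrightarrow> c \<in> {-1, 0, 1}) \<and>
     (\<forall>g\<in>set C. \<not> is_input g \<longrightarrow> length (gate_args g) = 2)"

definition VP0 :: "(nat \<Rightarrow> 'v ipoly) set" where
  "VP0 = {f. \<exists>(p :: nat poly) C. \<forall>n.
     constant_free (C n) \<and> circuit_poly (C n) = f n \<and>
     circuit_size (C n) \<le> poly p n \<and> formal_degree (C n) \<le> poly p n}"

section \<open>Depth four circuits and formulas\<close>

text \<open>Level 0 consists of the input gates, and wires go from each level to the next one only.\<close>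

definition depth_four_circuit :: "'v circuit \<Rightarrow> bool" where
  "depth_four_circuit C \<longleftrightarrow> is_circuit C \<and>
     (\<exists>lev :: nat \<Rightarrow> nat.
        (\<forall>i<length C.
           (is_input (C ! i) \<longrightarrow> lev i = 0) \<and>
           (is_mul (C ! i) \<longrightarrow> lev i \<in> {1, 3}) \<and>
           (is_add (C ! i) \<longrightarrow> lev i \<in> {2, 4}) \<and>
           (\<forall>j\<in>set (gate_args (C ! i)). lev i = lev j + 1) \<and>
           (lev i = 4 \<longleftrightarrow> i = length C - 1)))"

definition fan_out :: "'v circuit \<Rightarrow> nat \<Rightarrow> nat" where
  "fan_out C i = (\<Sum>g\<leftarrow>C. count_list (gate_args g) i)"

definition depth_four_formula :: "'v circuit \<Rightarrow> bool" where
  "depth_four_formula C \<longleftrightarrow> depth_four_circuit C \<and> (\<forall>i<length C - 1. fan_out C i = 1)"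

definition mul_fan_in_le :: "'v circuit \<Rightarrow> real \<Rightarrow> bool" where
  "mul_fan_in_le C b \<longleftrightarrow> (\<forall>js. Mul js \<in> set C \<longrightarrow> real (length js) \<le> b)"

text \<open>For positive \<open>a\<close>, \<open>floorlog 2 a\<close> is the number of binary digits of \<open>a\<close>.\<close>

definition poly_size_inputs :: "(nat \<Rightarrow> 'v ipoly) \<Rightarrow> (nat \<Rightarrow> 'v circuit) \<Rightarrow> bool" where
  "poly_size_inputs f C \<longleftrightarrow>
     (\<forall>n v. Var v \<in> set (C n) \<longrightarrow> v \<in> vars (f n)) \<and>
     (\<exists>q :: nat poly. \<forall>n c. Const c \<in> set (C n) \<longrightarrow> floorlog 2 (nat \<bar>c\<bar>) \<le> poly q n)"

section \<open>Growth rates\<close>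

text \<open>\<open>n_pow_O h g\<close> means that \<open>h\<close> is of order \<open>n\<close> to the power \<open>O(g)\<close>. The exponent bound
  is read as at least 1. This only matters where \<open>g n < 1\<close>: for \<open>g n = log 2 d\<close> or
  \<open>g n = sqrt d * log 2 d\<close> that is \<open>d \<le> 1\<close>, where a literal reading would give an
  undefined or vanishing exponent, whereas even the sum of \<open>n\<close> variables needs about \<open>n\<close>
  multiplication gates.\<close>

definition n_pow_O :: "(nat \<Rightarrow> nat) \<Rightarrow> (nat \<Rightarrow> real) \<Rightarrow> bool" where
  "n_pow_O h g \<longleftrightarrow>
     (\<exists>e. e \<in> O(\<lambda>n. max 1 (g n)) \<and> (\<forall>\<^sub>F n in sequentially. real (h n) \<le> real n powr e n))"

end

theory Submission
  imports Defs
begin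

text \<open>
  Split every gate of the given circuit into homogeneous components. A depth-first expansion of a
  component, always entering the factor of smaller degree first, keeps the pending factors on a
  stack of logarithmic height, so only \<open>n\<close> to the power \<open>O(log d)\<close> stacks occur. Stopping the
  expansion whenever \<open>k\<close> variables have been read writes the product of the gates on a stack of
  degree \<open>e\<close> as a combination of such products for stacks of degree \<open>e - k\<close>, whose coefficients are
  polynomials of degree at most \<open>k\<close>. For \<open>k\<close> about \<open>sqrt d\<close>, about \<open>sqrt d\<close> rounds turn the
  output into a sum of products of these coefficient polynomials, and each of them is written as
  an explicit sum of monomials.
\<close>

section \<open>Evaluation of circuits\<close>

text \<open>Inner gates may have degree far above \<open>d\<close> and use variables that cancel in
  the output, since only the formal degree of the given circuit is polynomially bounded. Keeping
  only components of degree at most \<open>d\<close> over the variables of the output removes both.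
  Components of degree 0 are integers; on a stack they would add height without degree, so they are
  moved into the coefficients. Degree is lost only when a variable is read, and then exactly 1,
  which is why \<open>k\<close> reads leave degree exactly \<open>e - k\<close>. There is one
  coefficient polynomial for each pair of stacks and number of variables read. The circuit shares
  them, so its addition gates cost only a logarithm in the exponent; the square root comes from the
  words of length at most \<open>k\<close> and from the \<open>k\<close> rounds of branching. The
  formula copies a polynomial for each use. Reaching degree 0 in \<open>k\<close> rounds requires
  \<open>d \<le> k * k\<close>, and \<open>k * k \<le> 3 * d\<close> can be had at the same time. A
  term then has \<open>k\<close> variables and a coefficient, a product at most \<open>k + 1\<close>
  factors, whence the fan-in.\<close>

lemma gate_values_Nil [simp]: "gate_values step [] = []"
  by (simp add: gate_values_def)

lemma gate_values_snoc [simp]: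
  "gate_values step (C @ [g]) = gate_values step C @ [step (gate_values step C) g]"
  by (simp add: gate_values_def)

lemma length_gate_values [simp]: "length (gate_values step C) = length C"
  by (induction C rule: rev_induct) auto

lemma take_gate_values: "take i (gate_values step C) = gate_values step (take i C)"
proof (induction C rule: rev_induct)
  case (snoc g C)
  then show ?case by (cases "i \<le> length C") auto
qed simp

lemma nth_gate_values:
  assumes "i < length C"
  shows "gate_values step C ! i = step (take i (gate_values step C)) (C ! i)"
proof -
  have "gate_values step C ! i = take (Suc i) (gate_values step C) ! i"
    by simp
  also have "\<dots> = gate_values step (take i C @ [C ! i]) ! i"
    by (simp add: take_gate_values take_Suc_conv_app_nth assms)
  also have "\<dots> = step (take i (gate_values step C)) (C ! i)"
    using assms by (simp only: gate_values_snoc) (simp add: nth_append take_gate_values)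
  finally show ?thesis .
qed

lemma poly_step_append:
  assumes "\<forall>j\<in>set (gate_args g). j < length vs"
  shows "poly_step (vs @ ws) g = poly_step vs g"
  using assms by (cases g) (auto simp: nth_append cong: map_cong)

text \<open>Gates that read only positions before their layer do not see one another, so a whole
  layer is evaluated at once from the values below it.\<close>

lemma gate_values_layer:
  assumes "\<forall>g\<in>set gs. \<forall>j\<in>set (gate_args g). j < length C"
  shows "gate_values poly_step (C @ gs) =
    gate_values poly_step C @ map (poly_step (gate_values poly_step C)) gs"
  using assms
proof (induction gs rule: rev_induct)
  case (snoc g gs)
  then show ?case
    by (simp add: poly_step_append flip: append_assoc)
qed simp

section \<open>Layered circuits of depth four\<close>

text \<open>Wires of a layer whose gates each have inputs of their own: the entries of
  \<open>concat xss\<close> are imagined at consecutive positions from \<open>n\<close> on.\<close>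

fun blocks :: "nat \<Rightarrow> 'a list list \<Rightarrow> nat list list" where
  "blocks n [] = []"
| "blocks n (xs # xss) = [n..<n + length xs] # blocks (n + length xs) xss"

lemma length_blocks [simp]: "length (blocks n xss) = length xss"
  by (induction xss arbitrary: n) auto

lemma concat_blocks: "concat (blocks n xss) = [n..<n + length (concat xss)]"
proof (induction xss arbitrary: n)
  case (Cons xs xss)
  then show ?case
    using upt_add_eq_append[of n "n + length xs" "length (concat xss)"] by (simp add: add.assoc)
qed simp

lemma set_blocks_bounds:
  assumes "js \<in> set (blocks n xss)" "j \<in> set js"
  shows "n \<le> j" "j < n + length (concat xss)"
proof -
  have "j \<in> set (concat (blocks n xss))"
    using assms by auto
  then show "n \<le> j" "j < n + length (concat xss)"
    by (auto simp: concat_blocks)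
qed

lemma map_nth_blocks:
  "map (map (\<lambda>j. (ys @ concat xss @ zs) ! j)) (blocks (length ys) xss) = xss"
proof (induction xss arbitrary: ys)
  case (Cons xs xss)
  have "map (\<lambda>j. (ys @ (xs @ concat xss) @ zs) ! j) [length ys..<length ys + length xs] = xs"
    by (rule nth_equalityI) (auto simp: nth_append)
  moreover have "map (map (\<lambda>j. ((ys @ xs) @ concat xss @ zs) ! j)) (blocks (length (ys @ xs)) xss) = xss"
    by (rule Cons)
  ultimately show ?case by simp
qed simp

lemma blocks_nonempty: "js \<in> set (blocks n xss) \<Longrightarrow> [] \<notin> set xss \<Longrightarrow> js \<noteq> []"
  by (induction xss arbitrary: n) (auto dest: sym)

lemma length_blocks_elem: "js \<in> set (blocks n xss) \<Longrightarrow> \<exists>xs\<in>set xss. length js = length xs"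
  by (induction xss arbitrary: n) auto

lemma blocks_map [simp]: "blocks n (map (map f) xss) = blocks n xss"
  by (induction xss arbitrary: n) auto

lemma map_nth_map_blocks:
  "map (map (\<lambda>j. (ys @ map f (concat xss)) ! j)) (blocks (length ys) xss) = map (map f) xss"
  using map_nth_blocks[of ys "map (map f) xss" "[]"] by (simp add: map_concat)

text \<open>An entry of \<open>qs\<close> is an addition gate, given as its list of terms, and a
  term is a list of input gates. An entry of \<open>ps\<close> is an upper multiplication gate,
  given by indices into \<open>qs\<close>. Inputs and terms are never shared; sharing is controlled
  by \<open>ps\<close> alone, so one construction serves circuits and formulas.\<close>

definition four_layers :: "'v gate list list list \<Rightarrow> nat list list \<Rightarrow> 'v circuit" where
  "four_layers qs ps =
    (let ts = concat qs; us = concat ts;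
         n1 = length us; n2 = n1 + length ts; n3 = n2 + length qs
     in us @ map Mul (blocks 0 ts) @ map Add (blocks n1 qs) @ map (\<lambda>p. Mul (map ((+) n2) p)) ps @
        [Add [n3..<n3 + length ps]])"

definition term_value :: "'v gate list \<Rightarrow> 'v ipoly" where
  "term_value t = prod_list (map (poly_step []) t)"

definition sum_value :: "'v gate list list \<Rightarrow> 'v ipoly" where
  "sum_value q = sum_list (map term_value q)"

lemma input_args: "is_input u \<Longrightarrow> gate_args u = []"
  by (cases u) auto

lemma count_list_upt: "i < n \<Longrightarrow> count_list [0..<n] i = 1"
  by (induction n) (auto simp: less_Suc_eq)

locale layers =
  fixes qs :: "'v gate list list list" and ps :: "nat list list"
  assumes inputs: "\<And>q t u. q \<in> set qs \<Longrightarrow> t \<in> set q \<Longrightarrow> u \<in> set t \<Longrightarrow> is_input u"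
    and sums_nonempty: "[] \<notin> set qs"
    and terms_nonempty: "\<And>q. q \<in> set qs \<Longrightarrow> [] \<notin> set q"
    and prods_nonempty: "ps \<noteq> []" "[] \<notin> set ps"
    and prods_bound: "\<And>p j. p \<in> set ps \<Longrightarrow> j \<in> set p \<Longrightarrow> j < length qs"
begin

abbreviation "ts \<equiv> concat qs"
abbreviation "us \<equiv> concat ts"
abbreviation "n1 \<equiv> length us"
abbreviation "n2 \<equiv> n1 + length ts"
abbreviation "n3 \<equiv> n2 + length qs"
abbreviation "L1 \<equiv> map Mul (blocks 0 ts) :: 'v circuit"
abbreviation "L2 \<equiv> map Add (blocks n1 qs) :: 'v circuit"
abbreviation "L3 \<equiv> map (\<lambda>p. Mul (map ((+) n2) p)) ps :: 'v circuit"
abbreviation "out \<equiv> Add [n3..<n3 + length ps] :: 'v gate"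

lemma four_layers_eq: "four_layers qs ps = us @ L1 @ L2 @ L3 @ [out]"
  by (simp add: four_layers_def Let_def)

lemma us_input: "u \<in> set us \<Longrightarrow> is_input u"
  using inputs by auto

lemma circuit_poly_four_layers:
  "circuit_poly (four_layers qs ps) = (\<Sum>p\<leftarrow>ps. \<Prod>j\<leftarrow>p. sum_value (qs ! j))"
proof -
  let ?v = "\<lambda>C. gate_values poly_step (C :: 'v circuit)"
  have v0: "?v us = map (poly_step []) us"
    using gate_values_layer[of us "[]"] us_input input_args by auto
  have "map (poly_step (?v us)) L1 = map (\<lambda>js. prod_list (map (\<lambda>j. ?v us ! j) js)) (blocks 0 ts)"
    by simp
  also have "\<dots> = map prod_list (map (map (\<lambda>j. ([] @ map (poly_step []) us) ! j)) (blocks (length ([] :: 'v ipoly list)) ts))"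
    by (simp add: v0)
  also have "\<dots> = map term_value ts"
    unfolding map_nth_map_blocks by (simp add: term_value_def comp_def)
  finally have v1: "?v (us @ L1) = ?v us @ map term_value ts"
    by (subst gate_values_layer) (auto dest: set_blocks_bounds)
  have "map (poly_step (?v (us @ L1))) L2 =
      map sum_list (map (map (\<lambda>j. (?v us @ map term_value ts) ! j)) (blocks (length (?v us)) qs))"
    by (simp add: v1)
  also have "\<dots> = map sum_value qs"
    unfolding map_nth_map_blocks by (simp add: sum_value_def)
  finally have v2: "?v ((us @ L1) @ L2) = ?v (us @ L1) @ map sum_value qs"
    by (subst gate_values_layer) (auto dest: set_blocks_bounds)
  have "map (poly_step (?v ((us @ L1) @ L2))) L3 =
      map (\<lambda>p. \<Prod>j\<leftarrow>p. sum_value (qs ! j)) ps"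
    using prods_bound by (auto simp: v2[unfolded append_assoc] nth_append comp_def intro!: arg_cong[where f = prod_list])
  then have v3: "?v (((us @ L1) @ L2) @ L3) =
      ?v ((us @ L1) @ L2) @ map (\<lambda>p. \<Prod>j\<leftarrow>p. sum_value (qs ! j)) ps"
    using prods_bound by (subst gate_values_layer) auto
  have "map (\<lambda>j. ?v (((us @ L1) @ L2) @ L3) ! j) [n3..<n3 + length ps] =
      map (\<lambda>p. \<Prod>j\<leftarrow>p. sum_value (qs ! j)) ps"
    by (rule nth_equalityI) (auto simp: v3[unfolded append_assoc] nth_append)
  then have "poly_step (?v (((us @ L1) @ L2) @ L3)) out = (\<Sum>p\<leftarrow>ps. \<Prod>j\<leftarrow>p. sum_value (qs ! j))"
    by simp
  moreover have "four_layers qs ps = (((us @ L1) @ L2) @ L3) @ [out]"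
    by (simp add: four_layers_eq)
  ultimately show ?thesis
    unfolding circuit_poly_def by (simp only: gate_values_snoc last_snoc)
qed

lemma length_four_layers: "length (four_layers qs ps) = n3 + length ps + 1"
  by (simp add: four_layers_eq)

text \<open>Acyclicity and the level function are both read off from this case distinction on the
  layer of a gate.\<close>

lemma nth_four_layers:
  assumes "i < length (four_layers qs ps)"
  obtains (0) "i < n1" "is_input (four_layers qs ps ! i)" "gate_args (four_layers qs ps ! i) = []"
  | (1) js where "n1 \<le> i" "i < n2" "four_layers qs ps ! i = Mul js" "js \<noteq> []" "\<forall>j\<in>set js. j < n1"
  | (2) js where "n2 \<le> i" "i < n3" "four_layers qs ps ! i = Add js" "js \<noteq> []" "\<forall>j\<in>set js. n1 \<le> j \<and> j < n2"
  | (3) js where "n3 \<le> i" "i < n3 + length ps" "four_layers qs ps ! i = Mul js" "js \<noteq> []"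
      "\<forall>j\<in>set js. n2 \<le> j \<and> j < n3"
  | (4) js where "i = n3 + length ps" "four_layers qs ps ! i = Add js" "js \<noteq> []"
      "\<forall>j\<in>set js. n3 \<le> j \<and> j < n3 + length ps"
proof -
  let ?C = "four_layers qs ps"
  consider "i < n1" | "n1 \<le> i" "i < n2" | "n2 \<le> i" "i < n3" | "n3 \<le> i" "i < n3 + length ps"
    | "i = n3 + length ps"
    using assms unfolding length_four_layers by linarith
  then show thesis
  proof cases
    case 1
    then have "?C ! i \<in> set us"
      unfolding four_layers_eq by (simp only: nth_append if_True nth_mem)
    then show thesis
      using that(1) 1 us_input input_args by blast
  next
    case 2
    define js where "js = blocks 0 ts ! (i - n1)"
    have js: "js \<in> set (blocks 0 ts)"
      using 2 by (auto simp: js_def)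
    have "?C ! i = Mul js"
      using 2 by (auto simp: four_layers_eq nth_append js_def)
    moreover have "js \<noteq> []"
      by (rule blocks_nonempty[OF js]) (use terms_nonempty in auto)
    ultimately show thesis
      using that(2) 2 set_blocks_bounds[OF js] by auto
  next
    case 3
    define js where "js = blocks n1 qs ! (i - n2)"
    have js: "js \<in> set (blocks n1 qs)"
      using 3 by (auto simp: js_def)
    have "?C ! i = Add js"
      using 3 by (auto simp: four_layers_eq nth_append js_def)
    moreover have "js \<noteq> []"
      by (rule blocks_nonempty[OF js]) (use sums_nonempty in auto)
    ultimately show thesis
      using that(3) 3 set_blocks_bounds[OF js] by auto
  next
    case 4
    define p where "p = ps ! (i - n3)"
    have p: "p \<in> set ps"
      using 4 by (auto simp: p_def)
    have "?C ! i = Mul (map ((+) n2) p)"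
      using 4 by (auto simp: four_layers_eq nth_append p_def)
    moreover have "p \<noteq> []"
      using p prods_nonempty by auto
    ultimately show thesis
      using that(4) 4 prods_bound[OF p] by auto
  next
    case 5
    have "?C ! i = out"
      using 5 by (auto simp: four_layers_eq nth_append)
    then show thesis
      using that(5) 5 prods_nonempty(1) by auto
  qed
qed

lemma depth_four_circuit_four_layers: "depth_four_circuit (four_layers qs ps)"
proof -
  let ?C = "four_layers qs ps"
  let ?lev = "\<lambda>i. if i < n1 then 0 else if i < n2 then 1 else if i < n3 then 2
    else if i < n3 + length ps then 3 else 4 :: nat"
  have circ: "is_circuit ?C"
    unfolding is_circuit_def
  proof (intro conjI allI impI)
    show "?C \<noteq> []" by (simp add: four_layers_eq)
  next
    fix i assume i: "i < length ?C"
    show "\<forall>j\<in>set (gate_args (?C ! i)). j < i"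
      using i by (cases rule: nth_four_layers) force+
    show "gate_args (?C ! i) \<noteq> []" if "\<not> is_input (?C ! i)"
      using i that by (cases rule: nth_four_layers) auto
  qed
  have lev: "(is_input (?C ! i) \<longrightarrow> ?lev i = 0) \<and> (is_mul (?C ! i) \<longrightarrow> ?lev i \<in> {1, 3}) \<and>
      (is_add (?C ! i) \<longrightarrow> ?lev i \<in> {2, 4}) \<and>
      (\<forall>j\<in>set (gate_args (?C ! i)). ?lev i = ?lev j + 1) \<and>
      (?lev i = 4 \<longleftrightarrow> i = length ?C - 1)" if "i < length ?C" for i
    using that
  proof (cases rule: nth_four_layers)
    case 0
    then show ?thesis by (cases "?C ! i") (auto simp: length_four_layers)
  next
    case 1
    then show ?thesis by (auto simp: length_four_layers)
  next
    case 2
    then show ?thesis by (auto simp: length_four_layers)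
  next
    case 3
    then show ?thesis by (fastforce simp: length_four_layers)
  next
    case (4 js)
    have "?lev j = 3" if "j \<in> set js" for j
      using that 4(4) by auto
    with 4 show ?thesis by (simp add: length_four_layers)
  qed
  show ?thesis
    unfolding depth_four_circuit_def
    by (rule conjI, rule circ, rule exI[of _ ?lev], intro allI impI, rule lev)
qed

lemma num_add_gates_four_layers: "num_add_gates (four_layers qs ps) = length qs + 1"
proof -
  have "filter is_add us = []"
    using us_input by (auto simp: filter_empty_conv) (metis is_add.elims(2) is_input.simps(3))
  then show ?thesis
    by (simp add: num_add_gates_def four_layers_eq filter_map comp_def)
qed

lemma num_mul_gates_four_layers: "num_mul_gates (four_layers qs ps) = length (concat qs) + length ps"
proof -
  have "filter is_mul us = []"
    using us_input by (auto simp: filter_empty_conv) (metis is_mul.elims(2) is_input.simps(4))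
  then show ?thesis
    by (simp add: num_mul_gates_def four_layers_eq filter_map comp_def)
qed

lemma input_in_four_layers:
  assumes "u \<in> set (four_layers qs ps)" "is_input u"
  shows "\<exists>q\<in>set qs. \<exists>t\<in>set q. u \<in> set t"
  using assms by (auto simp: four_layers_eq)

lemma mul_fan_in_four_layers:
  assumes "\<And>q t. q \<in> set qs \<Longrightarrow> t \<in> set q \<Longrightarrow> real (length t) \<le> b"
    and "\<And>p. p \<in> set ps \<Longrightarrow> real (length p) \<le> b"
  shows "mul_fan_in_le (four_layers qs ps) b"
  unfolding mul_fan_in_le_def
proof (intro allI impI)
  fix js assume "Mul js \<in> set (four_layers qs ps)"
  moreover have "Mul js \<notin> set us"
    using us_input by fastforce
  ultimately consider "js \<in> set (blocks 0 ts)" | p where "p \<in> set ps" "js = map ((+) n2) p"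
    by (auto simp: four_layers_eq)
  then show "real (length js) \<le> b"
  proof cases
    case 1
    then show ?thesis using length_blocks_elem[of js 0 ts] assms(1) by fastforce
  next
    case 2
    then show ?thesis using assms(2) by simp
  qed
qed

text \<open>The wires of the lower layers and of the output use each position once by construction.
  If \<open>ps\<close> also runs through all indices once, the joined argument lists of all gates
  enumerate the positions other than the output, and a fan-out is a count in this list.\<close>

lemma depth_four_formula_four_layers:
  assumes "concat ps = [0..<length qs]"
  shows "depth_four_formula (four_layers qs ps)"
proof -
  let ?C = "four_layers qs ps"
  have "concat (map gate_args us) = []"
    using us_input input_args by auto
  moreover have "concat (map gate_args L3) = map ((+) n2) (concat ps)"
    by (simp add: map_concat comp_def)
  moreover have "map ((+) n2) [0..<length qs] = [n2..<n3]"
    by (rule nth_equalityI) auto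
  moreover have "map gate_args L1 = blocks 0 ts" "map gate_args L2 = blocks n1 qs"
    by (simp_all add: comp_def)
  ultimately have "concat (map gate_args ?C) = [0..<n1] @ [n1..<n2] @ [n2..<n3] @ [n3..<n3 + length ps]"
    unfolding four_layers_eq map_append concat_append by (simp add: concat_blocks assms)
  also have "\<dots> = [0..<n3 + length ps]"
    by (simp only: upt_add_eq_append[OF le0] append_assoc)
  finally have args: "concat (map gate_args ?C) = [0..<length ?C - 1]"
    by (simp add: length_four_layers)
  have fan: "fan_out D i = count_list (concat (map gate_args D)) i" for D :: "'v circuit" and i
    by (induction D) (auto simp: fan_out_def)
  have "fan_out ?C i = 1" if "i < length ?C - 1" for i
    using that unfolding fan args by (rule count_list_upt)
  then show ?thesis
    using depth_four_circuit_four_layers by (simp add: depth_four_formula_def)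
qed

end

section \<open>Polynomials\<close>

lemma const_poly_add: "const_poly (a + b) = const_poly a + const_poly b"
  by (simp add: const_poly_def single_add)

lemma const_poly_mult: "const_poly (a * b) = const_poly a * const_poly b"
  by (simp add: const_poly_def mult_single)

lemma const_poly_0 [simp]: "const_poly 0 = 0"
  by (simp add: const_poly_def)

lemma const_poly_1 [simp]: "const_poly 1 = 1"
  by (simp add: const_poly_def)

section \<open>Degrees of monomials, and polynomials with prescribed monomials\<close>

lemma monom_degree_superset:
  assumes "finite A" "Poly_Mapping.keys m \<subseteq> A"
  shows "monom_degree m = (\<Sum>v\<in>A. Poly_Mapping.lookup m v)"
  unfolding monom_degree_def using assms
  by (intro sum.mono_neutral_left) (auto simp: in_keys_iff)

lemma keys_add_nat:
  fixes m n :: "'v \<Rightarrow>\<^sub>0 nat"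
  shows "Poly_Mapping.keys (m + n) = Poly_Mapping.keys m \<union> Poly_Mapping.keys n"
  by (auto simp: in_keys_iff lookup_add)

lemma monom_degree_add: "monom_degree (m + n) = monom_degree m + monom_degree n"
proof -
  let ?A = "Poly_Mapping.keys m \<union> Poly_Mapping.keys n"
  show ?thesis
    by (subst (1 2 3) monom_degree_superset[of ?A])
      (auto simp: keys_add_nat lookup_add sum.distrib)
qed

lemma monom_degree_0 [simp]: "monom_degree 0 = 0"
  by (simp add: monom_degree_def)

lemma monom_degree_single [simp]: "monom_degree (Poly_Mapping.single v e) = e"
  by (simp add: monom_degree_def)

lemma monom_degree_le_total_degree:
  "m \<in> Poly_Mapping.keys f \<Longrightarrow> monom_degree m \<le> total_degree f"
  unfolding total_degree_def by (intro Max_ge) auto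

lemma keys_subset_vars: "m \<in> Poly_Mapping.keys f \<Longrightarrow> Poly_Mapping.keys m \<subseteq> vars f"
  by (auto simp: vars_def)

text \<open>Degree bounds, homogeneity and negligibility are all constraints on the occurring
  monomials; the closure properties are proved once, for an arbitrary constraint
  \<open>P\<close>.\<close>

definition supported :: "(('v \<Rightarrow>\<^sub>0 nat) \<Rightarrow> bool) \<Rightarrow> 'v ipoly \<Rightarrow> bool" where
  "supported P f \<longleftrightarrow> (\<forall>m\<in>Poly_Mapping.keys f. P m)"

lemma supported_0 [simp]: "supported P 0"
  by (simp add: supported_def)

lemma supported_add: "supported P f \<Longrightarrow> supported P g \<Longrightarrow> supported P (f + g)"
  using keys_add[of f g] by (auto simp: supported_def)

lemma supported_diff: "supported P f \<Longrightarrow> supported P g \<Longrightarrow> supported P (f - g)"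
  using keys_diff[of f g] by (auto simp: supported_def)

lemma supported_sum: "(\<And>i. i \<in> I \<Longrightarrow> supported P (f i)) \<Longrightarrow> supported P (sum f I)"
  by (induction I rule: infinite_finite_induct) (auto intro: supported_add)

lemma supported_mult:
  assumes "supported P f" "supported Q g" "\<And>a b. P a \<Longrightarrow> Q b \<Longrightarrow> R (a + b)"
  shows "supported R (f * g)"
  using keys_mult[of f g] assms by (fastforce simp: supported_def)

lemma supported_mono: "supported P f \<Longrightarrow> (\<And>m. P m \<Longrightarrow> Q m) \<Longrightarrow> supported Q f"
  by (auto simp: supported_def)

lemma supported_True [simp]: "supported (\<lambda>_. True) f"
  by (simp add: supported_def)

lemma supported_disjoint_eq_0:
  assumes "supported P f" "supported Q f" "\<And>m. P m \<Longrightarrow> \<not> Q m"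
  shows "f = 0"
  using assms by (auto simp: supported_def simp flip: keys_eq_empty)

lemma supported_const: "P 0 \<Longrightarrow> supported P (const_poly c)"
  by (simp add: supported_def const_poly_def)

lemma supported_var: "P (Poly_Mapping.single v 1) \<Longrightarrow> supported P (var_poly v)"
  by (simp add: supported_def var_poly_def)

definition homogeneous :: "'v set \<Rightarrow> nat \<Rightarrow> 'v ipoly \<Rightarrow> bool" where
  "homogeneous V e = supported (\<lambda>m. Poly_Mapping.keys m \<subseteq> V \<and> monom_degree m = e)"

text \<open>The monomial ideal generated by the variables outside \<open>V\<close> and the monomials
  of degree above \<open>d\<close>. Working modulo it means setting those variables to 0 and
  truncating at degree \<open>d\<close>.\<close>

definition negligible :: "'v set \<Rightarrow> nat \<Rightarrow> 'v ipoly \<Rightarrow> bool" where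
  "negligible V d = supported (\<lambda>m. \<not> Poly_Mapping.keys m \<subseteq> V \<or> d < monom_degree m)"

lemma negligible_mult: "negligible V d f \<Longrightarrow> negligible V d (f * g)"
  unfolding negligible_def
  by (erule supported_mult[OF _ supported_True]) (auto simp: monom_degree_add keys_add_nat)

lemma homogeneous_mult: "homogeneous V i f \<Longrightarrow> homogeneous V j g \<Longrightarrow> homogeneous V (i + j) (f * g)"
  unfolding homogeneous_def by (erule (1) supported_mult) (auto simp: monom_degree_add keys_add_nat)

section \<open>Homogeneous components of the gates of a constant-free circuit\<close>

text \<open>Multiplication gates are assumed to have fan-in two.\<close>

fun hom_step :: "'v set \<Rightarrow> (nat \<Rightarrow> 'v ipoly) list \<Rightarrow> 'v gate \<Rightarrow> nat \<Rightarrow> 'v ipoly" where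
  "hom_step V hs (Var v) = (\<lambda>e. if e = 1 \<and> v \<in> V then var_poly v else 0)"
| "hom_step V hs (Const c) = (\<lambda>e. if e = 0 then const_poly c else 0)"
| "hom_step V hs (Add js) = (\<lambda>e. \<Sum>j\<leftarrow>js. (hs ! j) e)"
| "hom_step V hs (Mul js) = (\<lambda>e. \<Sum>i\<le>e. (hs ! (js ! 0)) i * (hs ! (js ! 1)) (e - i))"

locale cf_circuit =
  fixes C :: "'v circuit" and V :: "'v set"
  assumes cf: "constant_free C"
begin

definition P :: "nat \<Rightarrow> 'v ipoly" where
  "P i = gate_values poly_step C ! i"

definition D :: "nat \<Rightarrow> nat" where
  "D i = gate_values degree_step C ! i"

text \<open>The component of degree \<open>e\<close> of \<open>P i\<close> after the variables
  outside \<open>V\<close> are set to 0, computed along the circuit.\<close>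

definition H :: "nat \<Rightarrow> nat \<Rightarrow> 'v ipoly" where
  "H i = gate_values (hom_step V) C ! i"

text \<open>The inductions over gates use this rule: it replaces argument lists by two predecessors
  and unfolds value, formal degree and components together.\<close>

lemma gate_cases [consumes 1, case_names Var Const Add Mul]:
  assumes "i < length C"
  obtains (Var) v where "C ! i = Var v"
      "P i = var_poly v" "D i = 1" "\<And>e. H i e = (if e = 1 \<and> v \<in> V then var_poly v else 0)"
  | (Const) c where "C ! i = Const c" "c \<in> {-1, 0, 1}"
      "P i = const_poly c" "D i = 1" "\<And>e. H i e = (if e = 0 then const_poly c else 0)"
  | (Add) a b where "a < i" "b < i"
      "P i = P a + P b" "D i = max (D a) (D b)" "\<And>e. H i e = H a e + H b e"
  | (Mul) a b where "a < i" "b < i"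
      "P i = P a * P b" "D i = D a + D b" "\<And>e. H i e = (\<Sum>j\<le>e. H a j * H b (e - j))"
proof -
  note nth = nth_gate_values[OF assms]
  have mem: "C ! i \<in> set C"
    using assms by simp
  have two: "\<exists>a b. gate_args (C ! i) = [a, b] \<and> a < i \<and> b < i" if "\<not> is_input (C ! i)"
  proof -
    have "length (gate_args (C ! i)) = 2"
      using cf that mem by (auto simp: constant_free_def)
    then obtain a b where ab: "gate_args (C ! i) = [a, b]"
      by (auto simp: numeral_2_eq_2 length_Suc_conv)
    moreover have "\<forall>j\<in>set (gate_args (C ! i)). j < i"
      using cf assms by (auto simp: constant_free_def is_circuit_def)
    ultimately show ?thesis by auto
  qed
  show thesis
  proof (cases "C ! i")
    case (Var v)
    then show thesis
      by (intro that(1)[of v]) (auto simp: P_def D_def H_def nth)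
  next
    case (Const c)
    then have "c \<in> {-1, 0, 1}"
      using cf mem by (auto simp: constant_free_def)
    with Const show thesis
      by (intro that(2)[of c]) (auto simp: P_def D_def H_def nth)
  next
    case (Add js)
    with two obtain a b where "js = [a, b]" "a < i" "b < i"
      by auto
    with Add show thesis
      by (intro that(3)[of a b]) (auto simp: P_def D_def H_def nth)
  next
    case (Mul js)
    with two obtain a b where "js = [a, b]" "a < i" "b < i"
      by auto
    with Mul show thesis
      by (intro that(4)[of a b]) (auto simp: P_def D_def H_def nth)
  qed
qed

lemma D_pos: "i < length C \<Longrightarrow> 1 \<le> D i"
proof (induction i rule: less_induct)
  case (less i)
  from less.prems show ?case
    using less by (cases rule: gate_cases) (auto simp: le_max_iff_disj trans_le_add1)
qed

lemma P_degree: "i < length C \<Longrightarrow> supported (\<lambda>m. monom_degree m \<le> D i) (P i)"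
proof (induction i rule: less_induct)
  case (less i)
  from less.prems show ?case
  proof (cases rule: gate_cases)
    case (Add a b)
    then have "supported (\<lambda>m. monom_degree m \<le> D a) (P a)" "supported (\<lambda>m. monom_degree m \<le> D b) (P b)"
      using less by auto
    then show ?thesis
      unfolding Add(3,4) by (intro supported_add) (auto elim!: supported_mono)
  next
    case (Mul a b)
    then have "supported (\<lambda>m. monom_degree m \<le> D a) (P a)" "supported (\<lambda>m. monom_degree m \<le> D b) (P b)"
      using less by auto
    then show ?thesis
      unfolding Mul(3,4) by (rule supported_mult) (auto simp: monom_degree_add)
  qed (auto intro: supported_var supported_const)
qed

lemma H_homogeneous: "i < length C \<Longrightarrow> homogeneous V e (H i e)"
proof (induction i arbitrary: e rule: less_induct)
  case (less i)
  from less.prems show ?case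
  proof (cases rule: gate_cases)
    case (Add a b)
    then show ?thesis
      using less by (auto simp: homogeneous_def intro: supported_add)
  next
    case (Mul a b)
    have "homogeneous V e (H a j * H b (e - j))" if "j \<le> e" for j
      using homogeneous_mult[OF less.IH[of a j] less.IH[of b "e - j"]] Mul(1,2) less.prems that by simp
    then show ?thesis
      unfolding Mul(5) by (auto simp: homogeneous_def intro: supported_sum)
  qed (auto simp: homogeneous_def intro: supported_var supported_const)
qed

text \<open>The components are correct modulo the ideal of negligible polynomials, which absorbs
  whatever foreign variables and high degrees produce at inner gates.\<close>

lemma P_diff_negligible: "i < length C \<Longrightarrow> negligible V d (P i - (\<Sum>e\<le>d. H i e))"
proof (induction i rule: less_induct)
  case (less i)
  from less.prems show ?case
  proof (cases rule: gate_cases)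
    case (Var v)
    have "(\<Sum>e\<le>d. H i e) = (if 1 \<le> d \<and> v \<in> V then var_poly v else 0)"
      unfolding Var(4) by (cases "v \<in> V") (auto simp: sum.delta)
    then show ?thesis
      by (auto simp: Var(2) negligible_def intro!: supported_var)
  next
    case (Const c)
    then show ?thesis by (simp add: negligible_def sum.delta)
  next
    case (Add a b)
    have eq: "P i - (\<Sum>e\<le>d. H i e) = (P a - (\<Sum>e\<le>d. H a e)) + (P b - (\<Sum>e\<le>d. H b e))"
      by (simp add: Add sum.distrib)
    show ?thesis
      using less.IH[of a] less.IH[of b] less.prems Add(1,2)
      unfolding eq negligible_def by (auto intro!: supported_add)
  next
    case (Mul a b)
    let ?A = "\<Sum>e\<le>d. H a e" and ?B = "\<Sum>e\<le>d. H b e"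
    \<comment> \<open>Pairs of degrees in this triangle make up the components of the product up to
      degree \<open>d\<close>; all other pairs have total degree above \<open>d\<close> and are
      negligible.\<close>
    let ?low = "{(j, l). j + l \<le> d}"
    have fin: "finite ?low" "?low \<subseteq> {..d} \<times> {..d}"
      by (auto intro: finite_subset[of _ "{..d} \<times> {..d}"])
    have "?A * ?B = (\<Sum>(j, l)\<in>{..d} \<times> {..d}. H a j * H b l)"
      by (simp add: sum_product sum.cartesian_product)
    also have "\<dots> = (\<Sum>(j, l)\<in>?low. H a j * H b l) + (\<Sum>(j, l)\<in>{..d} \<times> {..d} - ?low. H a j * H b l)"
      using sum.subset_diff[OF fin(2)] by (simp add: add.commute)
    also have "(\<Sum>(j, l)\<in>?low. H a j * H b l) = (\<Sum>e\<le>d. H i e)"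
      unfolding Mul(5) by (rule sum.triangle_reindex_eq)
    \<comment> \<open>With \<open>A\<close> and \<open>B\<close> for the truncated sums,
      \<open>P a * P b - A * B\<close> equals \<open>(P a - A) * P b + (P b - B) * A\<close>; the
      last sum is the part of \<open>A * B\<close> outside the triangle.\<close>
    finally have "P i - (\<Sum>e\<le>d. H i e) =
        (P a - ?A) * P b + (P b - ?B) * ?A + (\<Sum>(j, l)\<in>{..d} \<times> {..d} - ?low. H a j * H b l)"
      by (simp add: Mul(3) algebra_simps)
    moreover have "negligible V d ((P a - ?A) * P b)" "negligible V d ((P b - ?B) * ?A)"
      using less Mul(1,2) by (auto intro!: negligible_mult)
    moreover have "negligible V d (\<Sum>(j, l)\<in>{..d} \<times> {..d} - ?low. H a j * H b l)"
      unfolding negligible_def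
    proof (rule supported_sum)
      fix x assume "x \<in> {..d} \<times> {..d} - ?low"
      then obtain j l where x: "x = (j, l)" "d < j + l"
        by (cases x) auto
      moreover have "homogeneous V (j + l) (H a j * H b l)"
        using Mul(1,2) less.prems by (auto intro!: homogeneous_mult H_homogeneous)
      ultimately show "supported (\<lambda>m. \<not> Poly_Mapping.keys m \<subseteq> V \<or> d < monom_degree m)
          (case x of (j, l) \<Rightarrow> H a j * H b l)"
        unfolding homogeneous_def by (auto elim: supported_mono)
    qed
    ultimately show ?thesis
      by (auto simp: negligible_def intro: supported_add)
  qed
qed

text \<open>With \<open>V\<close> and the degree bound read off from \<open>P i\<close> itself,
  neither side has a negligible monomial, while their difference has no others. So it
  vanishes.\<close>

lemma P_eq_sum_H:
  assumes i: "i < length C" and V: "V = vars (P i)"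
  shows "P i = (\<Sum>e\<le>total_degree (P i). H i e)"
proof -
  let ?d = "total_degree (P i)"
  let ?good = "\<lambda>m. Poly_Mapping.keys m \<subseteq> V \<and> monom_degree m \<le> ?d"
  have "supported ?good (P i)"
    using V by (auto simp: supported_def monom_degree_le_total_degree dest: keys_subset_vars)
  moreover have "supported ?good (\<Sum>e\<le>?d. H i e)"
    by (rule supported_sum, rule supported_mono[OF H_homogeneous[OF i, unfolded homogeneous_def]]) auto
  ultimately have "supported ?good (P i - (\<Sum>e\<le>?d. H i e))"
    by (rule supported_diff)
  then have "P i - (\<Sum>e\<le>?d. H i e) = 0"
    using P_diff_negligible[OF i, of ?d] unfolding negligible_def
    by (rule supported_disjoint_eq_0) auto
  then show ?thesis by simp
qed

lemma last_gate: "length C - 1 < length C"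
  using cf by (auto simp: constant_free_def is_circuit_def)

lemma circuit_poly_eq: "circuit_poly C = P (length C - 1)"
  using last_gate by (auto simp: circuit_poly_def P_def last_conv_nth simp flip: length_greater_0_conv)

lemma formal_degree_eq: "formal_degree C = D (length C - 1)"
  using last_gate by (auto simp: formal_degree_def D_def last_conv_nth simp flip: length_greater_0_conv)

lemma total_degree_le_formal_degree: "total_degree (circuit_poly C) \<le> formal_degree C"
  using P_degree[OF last_gate] unfolding circuit_poly_eq formal_degree_eq total_degree_def supported_def
  by auto

text \<open>This weight bounds the logarithms of the coefficients, and it decreases in every expansion
  step, even when a multiplication gate is replaced by both of its arguments.\<close>

definition W :: "nat \<Rightarrow> nat" where
  "W i = (i + 1) * D i"

lemma W_Add:
  assumes "a < i" "b < i" "D i = max (D a) (D b)" "1 \<le> D i"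
  shows "W a < W i" "W b < W i"
proof -
  have "W c < W i" if "c < i" "D c \<le> D i" for c
  proof -
    have "W c \<le> (c + 1) * D i"
      unfolding W_def using that by (intro mult_left_mono) auto
    also have "\<dots> < W i"
      unfolding W_def using that assms(4) by simp
    finally show ?thesis .
  qed
  then show "W a < W i" "W b < W i" using assms by auto
qed

text \<open>Both \<open>a + 1\<close> and \<open>b + 1\<close> are at most \<open>i\<close>, so the
  two weights sum to at most \<open>i * D i\<close>, which misses \<open>W i\<close> by
  \<open>D i\<close>, hence by at least 1.\<close>

lemma W_Mul:
  assumes "a < i" "b < i" "D i = D a + D b" "1 \<le> D i"
  shows "W a + W b < W i"
proof -
  have "W a + W b \<le> i * D a + i * D b"
    unfolding W_def using assms by (intro add_mono mult_right_mono) auto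
  also have "\<dots> < W i"
    using assms by (simp add: W_def algebra_simps) linarith
  finally show ?thesis .
qed

text \<open>An addition at most doubles the bound, which the drop of the weight by at least 1 pays
  for; a multiplication adds exponents, whose sum stays below the weight of the gate.\<close>

lemma H_0_const:
  "i < length C \<Longrightarrow> \<exists>c. H i 0 = const_poly c \<and> \<bar>c\<bar> \<le> 2 ^ W i"
proof (induction i rule: less_induct)
  case (less i)
  note D = D_pos[OF less.prems]
  from less.prems show ?case
  proof (cases rule: gate_cases)
    case (Var v)
    then show ?thesis by (intro exI[of _ 0]) auto
  next
    case (Const c)
    then have "\<bar>c\<bar> \<le> 1" by auto
    also have "(1 :: int) \<le> 2 ^ W i" by simp
    finally show ?thesis using Const by auto
  next
    case (Add a b)
    then obtain s t where st: "H a 0 = const_poly s" "\<bar>s\<bar> \<le> 2 ^ W a" "H b 0 = const_poly t" "\<bar>t\<bar> \<le> 2 ^ W b"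
      using less by (meson less_trans)
    have "\<bar>s + t\<bar> \<le> 2 ^ W a + 2 ^ W b"
      using st by linarith
    also have "\<dots> \<le> 2 ^ (W i - 1) + 2 ^ (W i - 1)"
      using W_Add[OF Add(1,2,4) D] by (intro add_mono power_increasing) auto
    also have "\<dots> = 2 ^ Suc (W i - 1)"
      by simp
    also have "Suc (W i - 1) = W i"
      using W_Add[OF Add(1,2,4) D] by simp
    finally show ?thesis
      using st Add(5) by (intro exI[of _ "s + t"]) (simp add: const_poly_add)
  next
    case (Mul a b)
    then obtain s t where st: "H a 0 = const_poly s" "\<bar>s\<bar> \<le> 2 ^ W a" "H b 0 = const_poly t" "\<bar>t\<bar> \<le> 2 ^ W b"
      using less by (meson less_trans)
    have "\<bar>s * t\<bar> \<le> 2 ^ W a * 2 ^ W b"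
      unfolding abs_mult using st by (intro mult_mono) auto
    also have "\<dots> \<le> 2 ^ W i"
      unfolding power_add[symmetric] using W_Mul[OF Mul(1,2,4) D] by (intro power_increasing) auto
    finally show ?thesis
      using st Mul(5) by (intro exI[of _ "s * t"]) (simp add: const_poly_mult)
  qed
qed

end

section \<open>Polynomials of bounded degree with bounded coefficients\<close>

definition var_lists :: "'v set \<Rightarrow> nat \<Rightarrow> 'v list set" where
  "var_lists V k = {xs. set xs \<subseteq> V \<and> length xs \<le> k}"

definition mon :: "'v list \<Rightarrow> 'v ipoly" where
  "mon xs = prod_list (map var_poly xs)"

text \<open>Monomials are represented redundantly, as words in the variables.\<close>

definition rep :: "'v set \<Rightarrow> nat \<Rightarrow> nat \<Rightarrow> 'v ipoly \<Rightarrow> bool" where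
  "rep V k N q \<longleftrightarrow> (\<exists>c. (\<forall>xs. \<bar>c xs\<bar> \<le> int N) \<and>
     q = (\<Sum>xs\<in>var_lists V k. const_poly (c xs) * mon xs))"

lemma finite_var_lists: "finite V \<Longrightarrow> finite (var_lists V k)"
  unfolding var_lists_def by (rule finite_lists_length_le)

lemma Nil_in_var_lists: "[] \<in> var_lists V k"
  by (simp add: var_lists_def)

lemma card_lists_le:
  assumes "finite A"
  shows "card {xs. set xs \<subseteq> A \<and> length xs \<le> k} \<le> (card A + 1) ^ k"
proof -
  have "(\<Sum>i\<le>k. card A ^ i) \<le> (\<Sum>i\<le>k. (k choose i) * card A ^ i)"
    by (intro sum_mono) (auto simp: Suc_le_eq)
  also have "\<dots> = (card A + 1) ^ k"
    using binomial_ring[of "card A" 1 k] by simp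
  finally show ?thesis
    by (simp add: card_lists_length_le[OF assms])
qed

lemma rep_0: "rep V k N 0"
  unfolding rep_def by (rule exI[of _ "\<lambda>_. 0"]) simp

lemma rep_const:
  assumes "finite V" "\<bar>a\<bar> \<le> int N"
  shows "rep V k N (const_poly a)"
  unfolding rep_def
proof (intro exI[of _ "\<lambda>xs. if xs = [] then a else 0"] conjI)
  have "(\<Sum>xs\<in>var_lists V k. const_poly (if xs = [] then a else 0) * mon xs)
      = (\<Sum>xs\<in>{[]}. const_poly (if xs = [] then a else 0) * mon xs)"
    using assms by (intro sum.mono_neutral_right) (auto simp: finite_var_lists Nil_in_var_lists)
  then show "const_poly a = (\<Sum>xs\<in>var_lists V k. const_poly (if xs = [] then a else 0) * mon xs)"
    by (simp add: mon_def)
qed (use assms in auto)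

lemma rep_add:
  assumes "rep V k N p" "rep V k M q"
  shows "rep V k (N + M) (p + q)"
proof -
  obtain c where c: "\<And>xs. \<bar>c xs\<bar> \<le> int N" "p = (\<Sum>xs\<in>var_lists V k. const_poly (c xs) * mon xs)"
    using assms(1) by (auto simp: rep_def)
  obtain d where d: "\<And>xs. \<bar>d xs\<bar> \<le> int M" "q = (\<Sum>xs\<in>var_lists V k. const_poly (d xs) * mon xs)"
    using assms(2) by (auto simp: rep_def)
  have "\<bar>c xs + d xs\<bar> \<le> int (N + M)" for xs
    using c(1)[of xs] d(1)[of xs] by simp
  then show ?thesis
    unfolding rep_def
    by (intro exI[of _ "\<lambda>xs. c xs + d xs"]) (simp add: c(2) d(2) const_poly_add algebra_simps sum.distrib)
qed

lemma rep_scale: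
  assumes "rep V k N p" "\<bar>a\<bar> \<le> int M"
  shows "rep V k (M * N) (const_poly a * p)"
proof -
  obtain c where c: "\<And>xs. \<bar>c xs\<bar> \<le> int N" "p = (\<Sum>xs\<in>var_lists V k. const_poly (c xs) * mon xs)"
    using assms(1) by (auto simp: rep_def)
  have "\<bar>a * c xs\<bar> \<le> int (M * N)" for xs
    using c(1)[of xs] assms(2) by (simp add: abs_mult mult_mono)
  then show ?thesis
    unfolding rep_def
    by (intro exI[of _ "\<lambda>xs. a * c xs"]) (simp add: c(2) const_poly_mult sum_distrib_left mult.assoc)
qed

text \<open>Prefixing \<open>v\<close> to words is injective, so coefficients are moved and never
  added. Reading a variable is therefore free for the bound \<open>N\<close>.\<close>

lemma rep_var:
  assumes V: "finite V" "v \<in> V" and p: "rep V k N p"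
  shows "rep V (Suc k) N (var_poly v * p)"
proof -
  obtain c where c: "\<And>xs. \<bar>c xs\<bar> \<le> int N" "p = (\<Sum>xs\<in>var_lists V k. const_poly (c xs) * mon xs)"
    using p by (auto simp: rep_def)
  define c' where "c' ys = (if ys \<in> Cons v ` var_lists V k then c (tl ys) else 0)" for ys
  have "(\<Sum>ys\<in>var_lists V (Suc k). const_poly (c' ys) * mon ys)
      = (\<Sum>ys\<in>Cons v ` var_lists V k. const_poly (c' ys) * mon ys)"
    using V by (intro sum.mono_neutral_right finite_var_lists) (auto simp: c'_def var_lists_def)
  also have "\<dots> = (\<Sum>xs\<in>var_lists V k. const_poly (c' (v # xs)) * mon (v # xs))"
    by (subst sum.reindex) auto
  also have "\<dots> = (\<Sum>xs\<in>var_lists V k. var_poly v * (const_poly (c xs) * mon xs))"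
    by (rule sum.cong) (auto simp: c'_def mon_def mult_ac)
  also have "\<dots> = var_poly v * p"
    by (simp add: c(2) sum_distrib_left)
  finally show ?thesis
    using c(1) unfolding rep_def by (intro exI[of _ c']) (simp add: c'_def)
qed

lemma rep_mono:
  assumes "finite V" "rep V k N p" "k \<le> l" "N \<le> M"
  shows "rep V l M p"
proof -
  obtain c where c: "\<And>xs. \<bar>c xs\<bar> \<le> int N" "p = (\<Sum>xs\<in>var_lists V k. const_poly (c xs) * mon xs)"
    using assms(2) by (auto simp: rep_def)
  define c' where "c' xs = (if xs \<in> var_lists V k then c xs else 0)" for xs
  have "(\<Sum>xs\<in>var_lists V l. const_poly (c' xs) * mon xs) = (\<Sum>xs\<in>var_lists V k. const_poly (c' xs) * mon xs)"
    using assms(1,3) by (intro sum.mono_neutral_right finite_var_lists) (auto simp: c'_def var_lists_def)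
  also have "\<dots> = p"
    unfolding c(2) by (rule sum.cong) (auto simp: c'_def)
  finally show ?thesis
    using order_trans[OF c(1), of "int M"] assms(4)
    unfolding rep_def by (intro exI[of _ c']) (auto simp: c'_def)
qed

section \<open>Decomposition along stacks of gates\<close>

lemma sum_list_map_concat: "(\<Sum>x\<leftarrow>concat xss. f x) = (\<Sum>xs\<leftarrow>xss. \<Sum>x\<leftarrow>xs. f x)"
  by (induction xss) auto

text \<open>A stack lists the factors still to be expanded in a depth-first traversal of a parse tree
  that visits the child of smaller degree first: every entry dominates the sum of the entries
  above it, which keeps the height logarithmic.\<close>

fun dominating :: "nat \<Rightarrow> nat list \<Rightarrow> bool" where
  "dominating s [] \<longleftrightarrow> True"
| "dominating s (e # es) \<longleftrightarrow> 1 \<le> e \<and> s \<le> e \<and> dominating (s + e) es"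

text \<open>For removing the top entry of a stack once its variable has been read.\<close>

lemma dominating_antimono: "dominating s es \<Longrightarrow> r \<le> s \<Longrightarrow> dominating r es"
proof (induction es arbitrary: r s)
  case (Cons e es)
  have "dominating (s + e) es" "r + e \<le> s + e"
    using Cons.prems by simp_all
  then have "dominating (r + e) es"
    by (rule Cons.IH)
  with Cons.prems show ?case by simp
qed simp

text \<open>Passing an entry adds at least \<open>s\<close> to the running sum \<open>s\<close>,
  which therefore doubles with every entry.\<close>

lemma dominating_exponential: "dominating s es \<Longrightarrow> s * 2 ^ length es \<le> s + sum_list es"
proof (induction es arbitrary: s)
  case (Cons e es)
  have "s * 2 ^ length (e # es) \<le> (s + e) * 2 ^ length es"
    using Cons.prems by (simp add: algebra_simps)
  also have "\<dots> \<le> (s + e) + sum_list es"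
    using Cons by simp
  finally show ?case by simp
qed simp

lemma dominating_length: 
  assumes "dominating 0 es"
  shows "length es \<le> floorlog 2 (sum_list es)"
proof (cases es)
  case (Cons e es')
  \<comment> \<open>The top entry, being at least 1, starts the doubling, and only the entries below
    it continue it; hence the lost unit in the exponent.\<close>
  have "2 ^ (length es - 1) \<le> e * 2 ^ length es'"
    using assms Cons by simp
  also have "\<dots> \<le> sum_list es"
    using dominating_exponential[of e es'] assms Cons by simp
  finally show ?thesis
    by (rule floorlog_geI) simp
qed simp

context cf_circuit
begin

text \<open>Restricting to labels of gates makes the number of variables at most the size of the
  circuit, whatever \<open>V\<close> is.\<close>

definition U :: "'v set" where
  "U = {v \<in> V. Var v \<in> set C}"

definition deg :: "(nat \<times> nat) list \<Rightarrow> nat" where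
  "deg \<sigma> = sum_list (map snd \<sigma>)"

definition Wt :: "(nat \<times> nat) list \<Rightarrow> nat" where
  "Wt \<sigma> = (\<Sum>(i, e)\<leftarrow>\<sigma>. W i)"

definition PS :: "(nat \<times> nat) list \<Rightarrow> 'v ipoly" where
  "PS \<sigma> = (\<Prod>(i, e)\<leftarrow>\<sigma>. H i e)"

text \<open>An entry \<open>(i, e)\<close> stands for the factor \<open>H i e\<close>, the head
  being the top. Dominance makes every degree positive, so components of degree 0 never occur on a
  stack.\<close>

definition stack :: "(nat \<times> nat) list \<Rightarrow> bool" where
  "stack \<sigma> \<longleftrightarrow> fst ` set \<sigma> \<subseteq> {..<length C} \<and> dominating 0 (map snd \<sigma>)"

text \<open>Expansion never increases the weight, so a stack left over by one round again has weight
  at most \<open>B\<close>. One \<open>B\<close> thus limits the coefficients of all rounds.\<close>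

definition T :: "nat \<Rightarrow> nat \<Rightarrow> (nat \<times> nat) list set" where
  "T B e = {\<tau>. stack \<tau> \<and> Wt \<tau> \<le> B \<and> deg \<tau> = e}"

text \<open>A superset of the stacks of degree at most \<open>d\<close> that is just a set of short
  lists and hence easy to count.\<close>

definition all_stacks :: "nat \<Rightarrow> (nat \<times> nat) list set" where
  "all_stacks d = {\<tau>. set \<tau> \<subseteq> {..<length C} \<times> {..d} \<and> length \<tau> \<le> floorlog 2 d}"

lemmas stack_simps = deg_def Wt_def PS_def

lemma finite_U: "finite U"
proof -
  have "U \<subseteq> (\<lambda>g. case g of Var v \<Rightarrow> v | _ \<Rightarrow> undefined) ` set C"
    by (force simp: U_def)
  then show ?thesis by (rule finite_subset) simp
qed

lemma card_U: "card U \<le> length C"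
proof -
  have "card U = card (Var ` U :: 'v gate set)"
    by (rule card_image[symmetric]) (simp add: inj_on_def)
  also have "\<dots> \<le> card (set C)"
    by (rule card_mono) (auto simp: U_def)
  also have "\<dots> \<le> length C"
    by (rule card_length)
  finally show ?thesis .
qed

lemma finite_all_stacks: "finite (all_stacks d)"
  unfolding all_stacks_def by (rule finite_lists_length_le) simp

lemma card_all_stacks: "card (all_stacks d) \<le> (length C * (d + 1) + 1) ^ floorlog 2 d"
  using card_lists_le[of "{..<length C} \<times> {..d}" "floorlog 2 d"] by (simp add: all_stacks_def)

lemma stack_subset_all_stacks:
  assumes "stack \<sigma>" "deg \<sigma> \<le> d"
  shows "\<sigma> \<in> all_stacks d"
proof -
  have "e \<le> deg \<sigma>" if "(i, e) \<in> set \<sigma>" for i e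
    unfolding deg_def using that by (intro member_le_sum_list) (auto intro: rev_image_eqI)
  moreover have "length \<sigma> \<le> floorlog 2 (deg \<sigma>)"
    using dominating_length[of "map snd \<sigma>"] assms by (simp add: stack_def deg_def)
  ultimately show ?thesis
    using assms floorlog_mono[of "deg \<sigma>" d 2]
    by (fastforce simp: all_stacks_def stack_def)
qed

lemma T_subset: "e \<le> d \<Longrightarrow> T B e \<subseteq> all_stacks d"
  by (auto simp: T_def intro: stack_subset_all_stacks)

lemma finite_T: "finite (T B e)"
  using T_subset[of e e B] finite_all_stacks by (auto intro: finite_subset)

text \<open>\<open>k\<close> bounds the number of variables read, \<open>e\<close> is the exact
  degree left on the stacks, and \<open>N\<close> bounds coefficients. \<open>Q \<tau>\<close> is
  controlled for every \<tau>, also outside \<open>T B e\<close>, since the coefficient polynomials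
  are later collected over all of \<open>all_stacks\<close>.\<close>

definition decomposes :: "nat \<Rightarrow> nat \<Rightarrow> nat \<Rightarrow> nat \<Rightarrow> 'v ipoly \<Rightarrow> bool" where
  "decomposes B k e N p \<longleftrightarrow>
    (\<exists>Q. (\<forall>\<tau>. rep U k N (Q \<tau>)) \<and> p = (\<Sum>\<tau>\<in>T B e. Q \<tau> * PS \<tau>))"

lemma decomposes_0: "decomposes B k e N 0"
  unfolding decomposes_def by (rule exI[of _ "\<lambda>_. 0"]) (simp add: rep_0)

lemma decomposes_add:
  assumes "decomposes B k e N p" "decomposes B k e M q"
  shows "decomposes B k e (N + M) (p + q)"
proof -
  obtain Q R where "\<And>\<tau>. rep U k N (Q \<tau>)" "p = (\<Sum>\<tau>\<in>T B e. Q \<tau> * PS \<tau>)"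
    "\<And>\<tau>. rep U k M (R \<tau>)" "q = (\<Sum>\<tau>\<in>T B e. R \<tau> * PS \<tau>)"
    using assms by (auto simp: decomposes_def)
  then show ?thesis
    unfolding decomposes_def
    by (intro exI[of _ "\<lambda>\<tau>. Q \<tau> + R \<tau>"]) (simp add: rep_add distrib_right sum.distrib)
qed

lemma decomposes_sum:
  assumes "finite I" "\<And>i. i \<in> I \<Longrightarrow> decomposes B k e N (p i)"
  shows "decomposes B k e (card I * N) (\<Sum>i\<in>I. p i)"
  using assms
proof (induction I rule: finite_induct)
  case (insert i I)
  then have "decomposes B k e (N + card I * N) (p i + sum p I)"
    by (intro decomposes_add) auto
  with insert show ?case by simp
qed (simp add: decomposes_0)

lemma decomposes_scale:
  assumes "decomposes B k e N p" "\<bar>a\<bar> \<le> int M"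
  shows "decomposes B k e (M * N) (const_poly a * p)"
proof -
  obtain Q where "\<And>\<tau>. rep U k N (Q \<tau>)" "p = (\<Sum>\<tau>\<in>T B e. Q \<tau> * PS \<tau>)"
    using assms by (auto simp: decomposes_def)
  then show ?thesis
    unfolding decomposes_def using assms(2)
    by (intro exI[of _ "\<lambda>\<tau>. const_poly a * Q \<tau>"]) (simp add: rep_scale sum_distrib_left mult.assoc)
qed

lemma decomposes_var:
  assumes "decomposes B k e N p" "v \<in> U"
  shows "decomposes B (Suc k) e N (var_poly v * p)"
proof -
  obtain Q where "\<And>\<tau>. rep U k N (Q \<tau>)" "p = (\<Sum>\<tau>\<in>T B e. Q \<tau> * PS \<tau>)"
    using assms by (auto simp: decomposes_def)
  then show ?thesis
    unfolding decomposes_def using assms(2)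
    by (intro exI[of _ "\<lambda>\<tau>. var_poly v * Q \<tau>"])
      (simp add: rep_var finite_U sum_distrib_left mult.assoc)
qed

lemma decomposes_mono:
  assumes "decomposes B k e N p" "N \<le> M"
  shows "decomposes B k e M p"
proof -
  obtain Q where "\<And>\<tau>. rep U k N (Q \<tau>)" "p = (\<Sum>\<tau>\<in>T B e. Q \<tau> * PS \<tau>)"
    using assms by (auto simp: decomposes_def)
  then show ?thesis
    unfolding decomposes_def
    using rep_mono[OF finite_U _ order_refl assms(2)] by (intro exI[of _ Q]) simp
qed

text \<open>Induction on the weight, expanding the top entry until \<open>k\<close> variables have
  been read. A read lowers \<open>k\<close> and the degree by 1; every other step keeps both. A step
  combines at most \<open>M\<close> decompositions, each with bound at most
  \<open>M ^ (Wt \<sigma> - 1)\<close>, so \<open>M ^ Wt \<sigma>\<close> absorbs the number of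
  summands.\<close>

lemma decomposes_stack:
  assumes "2 \<le> M"
  shows "stack \<sigma> \<Longrightarrow> Wt \<sigma> \<le> B \<Longrightarrow> k \<le> deg \<sigma> \<Longrightarrow> deg \<sigma> < M \<Longrightarrow>
    decomposes B k (deg \<sigma> - k) (M ^ Wt \<sigma>) (PS \<sigma>)"
proof (induction "Wt \<sigma>" arbitrary: \<sigma> k rule: less_induct)
  case less
  have pow: "M ^ n \<le> M ^ m" if "n \<le> m" for n m
    using that assms by (intro power_increasing) auto
  show ?case
  proof (cases k)
    case 0
    \<comment> \<open>Nothing is left to read: the stack itself is the only term, with coefficient
      1.\<close>
    have "PS \<sigma> = (\<Sum>\<tau>\<in>T B (deg \<sigma>). (if \<tau> = \<sigma> then 1 else 0) * PS \<tau>)"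
    proof -
      have "(\<Sum>\<tau>\<in>T B (deg \<sigma>). (if \<tau> = \<sigma> then 1 else 0) * PS \<tau>)
          = (\<Sum>\<tau>\<in>T B (deg \<sigma>). if \<tau> = \<sigma> then PS \<tau> else 0)"
        by (intro sum.cong) auto
      also have "\<dots> = PS \<sigma>"
        using less.prems by (simp add: sum.delta' finite_T) (simp add: T_def)
      finally show ?thesis by simp
    qed
    moreover have "rep U k (M ^ Wt \<sigma>) (if \<tau> = \<sigma> then 1 else 0)" for \<tau>
      using rep_const[OF finite_U, of 1 "M ^ Wt \<sigma>" k] pow[of 0 "Wt \<sigma>"]
      by (auto simp: rep_0 simp del: of_nat_power)
    ultimately show ?thesis
      unfolding decomposes_def using 0 by (intro exI[of _ "\<lambda>\<tau>. if \<tau> = \<sigma> then 1 else 0"]) simp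
  next
    case (Suc k')
    then obtain i e \<rho> where \<sigma>: "\<sigma> = (i, e) # \<rho>"
      using less.prems(3) by (cases \<sigma>) (auto simp: deg_def)
    have i: "i < length C" and e: "1 \<le> e" and dom: "dominating e (map snd \<rho>)"
      and \<rho>: "fst ` set \<rho> \<subseteq> {..<length C}"
      using less.prems(1) by (auto simp: \<sigma> stack_def)
    have Wt: "Wt \<sigma> = W i + Wt \<rho>" and deg: "deg \<sigma> = e + deg \<rho>" and PS: "PS \<sigma> = H i e * PS \<rho>"
      by (simp_all add: \<sigma> stack_simps)
    note D = D_pos[OF i]
    have IH: "decomposes B l (deg \<tau> - l) (M ^ Wt \<tau>) (PS \<tau>)"
      if "stack \<tau>" "Wt \<tau> < Wt \<sigma>" "l \<le> deg \<tau>" "deg \<tau> \<le> deg \<sigma>" for \<tau> l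
      using less.hyps[of \<tau> l] less.prems that by auto
    have replace: "decomposes B k (deg \<sigma> - k) (M ^ (W a + Wt \<rho>)) (H a e * PS \<rho>)"
      if "a < i" "W a < W i" for a
    proof -
      have "stack ((a, e) # \<rho>)"
        using that i e dom \<rho> by (auto simp: stack_def)
      from IH[OF this, of k] show ?thesis
        using that less.prems(3) Wt deg by (simp add: stack_simps)
    qed
    from i show ?thesis
    proof (cases rule: gate_cases)
      case (Var v)
      show ?thesis
      proof (cases "e = 1 \<and> v \<in> V")
        case True
        have "stack \<rho>"
          using \<rho> dominating_antimono[OF dom] by (simp add: stack_def)
        moreover have "0 < W i"
          using D by (simp add: W_def)
        ultimately have "decomposes B k' (deg \<rho> - k') (M ^ Wt \<rho>) (PS \<rho>)"
          using IH[of \<rho> k'] less.prems(3) Wt deg True Suc by simp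
        moreover have "v \<in> U"
          using True Var(1) i by (auto simp: U_def intro: nth_mem[of i C, THEN back_subst[of "\<lambda>x. x \<in> set C"]])
        ultimately have "decomposes B k (deg \<rho> - k') (M ^ Wt \<rho>) (var_poly v * PS \<rho>)"
          unfolding Suc by (rule decomposes_var)
        moreover have "deg \<sigma> - k = deg \<rho> - k'"
          using True deg Suc by simp
        moreover have "PS \<sigma> = var_poly v * PS \<rho>"
          using True PS Var(4) by simp
        ultimately show ?thesis
          using decomposes_mono pow Wt by simp
      next
        case False
        then show ?thesis by (simp only: PS Var(4) if_False) (simp add: decomposes_0)
      qed
    next
      case (Const c)
      then show ?thesis using e PS by (simp add: decomposes_0)
    next
      case (Add a b)
      note lt = W_Add[OF Add(1,2,4) D]
      have "decomposes B k (deg \<sigma> - k) (M ^ (W a + Wt \<rho>) + M ^ (W b + Wt \<rho>))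
          (H a e * PS \<rho> + H b e * PS \<rho>)"
        using Add(1,2) lt by (intro decomposes_add replace)
      moreover have "M ^ (W a + Wt \<rho>) + M ^ (W b + Wt \<rho>) \<le> M ^ Wt \<sigma>"
      proof -
        have "M ^ (W a + Wt \<rho>) \<le> M ^ (Wt \<sigma> - 1)" "M ^ (W b + Wt \<rho>) \<le> M ^ (Wt \<sigma> - 1)"
          using lt Wt by (auto intro!: pow)
        then have "M ^ (W a + Wt \<rho>) + M ^ (W b + Wt \<rho>) \<le> 2 * M ^ (Wt \<sigma> - 1)"
          by simp
        also have "\<dots> \<le> M * M ^ (Wt \<sigma> - 1)"
          using assms by simp
        also have "\<dots> = M ^ Wt \<sigma>"
          using lt Wt by (simp flip: power_Suc)
        finally show ?thesis .
      qed
      ultimately show ?thesis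
        using decomposes_mono by (simp add: PS Add(5) distrib_right)
    next
      case (Mul a b)
      note lt = W_Mul[OF Mul(1,2,4) D]
      \<comment> \<open>A factor of degree 0 is an integer and goes into the coefficients, its size
        being paid by its own weight; the other factor takes the place of the top entry.\<close>
      have const: "decomposes B k (deg \<sigma> - k) (M ^ (Wt \<sigma> - 1)) (H a' 0 * (H b' e * PS \<rho>))"
        if h: "a' < i" "b' < i" "W a' + W b' < W i" for a' b'
      proof -
        have "a' < length C"
          using h i by simp
        then obtain c where c: "H a' 0 = const_poly c" "\<bar>c\<bar> \<le> 2 ^ W a'"
          using H_0_const by blast
        have "(2 :: int) ^ W a' \<le> int (M ^ W a')"
          using assms by (simp add: power_mono)
        with c(2) have "\<bar>c\<bar> \<le> int (M ^ W a')"
          by (rule order_trans)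
        moreover have "decomposes B k (deg \<sigma> - k) (M ^ (W b' + Wt \<rho>)) (H b' e * PS \<rho>)"
          using h by (intro replace) auto
        ultimately have "decomposes B k (deg \<sigma> - k) (M ^ W a' * M ^ (W b' + Wt \<rho>)) (H a' 0 * (H b' e * PS \<rho>))"
          unfolding c(1) by (intro decomposes_scale)
        moreover have "M ^ W a' * M ^ (W b' + Wt \<rho>) \<le> M ^ (Wt \<sigma> - 1)"
          unfolding power_add[symmetric] using h Wt by (intro pow) simp
        ultimately show ?thesis
          by (rule decomposes_mono)
      qed
      \<comment> \<open>The factor of smaller degree goes on top, so \<open>j \<le> l\<close> gives
        dominance between the two; since \<open>j + l = e\<close>, the entries of \<rho> have the
        same sum above them as before.\<close>
      have split: "decomposes B k (deg \<sigma> - k) (M ^ (Wt \<sigma> - 1)) (H a' j * (H b' l * PS \<rho>))"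
        if "a' < i" "b' < i" "W a' + W b' < W i" "1 \<le> j" "j \<le> l" "j + l = e" for a' b' j l
      proof -
        let ?\<tau> = "(a', j) # (b', l) # \<rho>"
        have \<tau>: "stack ?\<tau>" "Wt ?\<tau> < Wt \<sigma>" "deg ?\<tau> = deg \<sigma>"
          using that i \<rho> dom Wt deg by (auto simp: stack_def stack_simps)
        have "decomposes B k (deg \<sigma> - k) (M ^ Wt ?\<tau>) (PS ?\<tau>)"
          using IH[OF \<tau>(1,2), of k] less.prems(3) \<tau>(3) by simp
        moreover have "PS ?\<tau> = H a' j * (H b' l * PS \<rho>)"
          by (simp add: PS_def)
        moreover have "M ^ Wt ?\<tau> \<le> M ^ (Wt \<sigma> - 1)"
          by (rule pow) (use \<tau>(2) in linarith)
        ultimately show ?thesis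
          using decomposes_mono by metis
      qed
      have "decomposes B k (deg \<sigma> - k) (M ^ (Wt \<sigma> - 1)) (H a j * H b (e - j) * PS \<rho>)" if je: "j \<le> e" for j
      proof -
        consider "j = 0" | "j = e" | "1 \<le> j" "1 \<le> e - j" "j \<le> e - j" | "1 \<le> j" "1 \<le> e - j" "e - j \<le> j"
          using je by linarith
        then show ?thesis
        proof cases
          case 1
          then show ?thesis using const[of a b] Mul(1,2) lt by (simp add: mult.assoc)
        next
          case 2
          then show ?thesis using const[of b a] Mul(1,2) lt by (simp add: mult_ac add.commute)
        next
          case 3
          then show ?thesis using split[of a b j "e - j"] je Mul(1,2) lt by (simp add: mult_ac)
        next
          case 4
          then show ?thesis using split[of b a "e - j" j] je Mul(1,2) lt by (simp add: mult_ac add.commute)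
        qed
      qed
      then have "decomposes B k (deg \<sigma> - k) (card {..e} * M ^ (Wt \<sigma> - 1))
          (\<Sum>j\<le>e. H a j * H b (e - j) * PS \<rho>)"
        by (intro decomposes_sum) auto
      \<comment> \<open>There are \<open>e + 1\<close> splittings of the degree, and
        \<open>e \<le> deg \<sigma> < M\<close>.\<close>
      moreover have "card {..e} * M ^ (Wt \<sigma> - 1) \<le> M ^ Wt \<sigma>"
      proof -
        have "card {..e} * M ^ (Wt \<sigma> - 1) \<le> M * M ^ (Wt \<sigma> - 1)"
          using less.prems(4) deg by (intro mult_right_mono) auto
        also have "\<dots> = M ^ Wt \<sigma>"
          using lt Wt by (simp flip: power_Suc)
        finally show ?thesis .
      qed
      ultimately show ?thesis
        using decomposes_mono by (simp add: PS Mul(5) sum_distrib_right)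
    qed
  qed
qed

section \<open>Iterating the decomposition down to the empty stack\<close>

lemma stack_deg_0: "stack \<sigma> \<Longrightarrow> deg \<sigma> = 0 \<Longrightarrow> \<sigma> = []"
  by (cases \<sigma>) (auto simp: stack_def deg_def)

text \<open>Each round replaces a stack by at most \<open>card (all_stacks d)\<close> stacks,
  contributes one factor to each product, and lowers the degree by \<open>k\<close> until it is
  exhausted. The family \<open>Q\<close> is fixed beforehand, so that the factors of all rounds come
  from one set \<open>QQ\<close>.\<close>

lemma stack_sum_of_products:
  assumes Q: "\<And>\<sigma> l. stack \<sigma> \<Longrightarrow> Wt \<sigma> \<le> B \<Longrightarrow> deg \<sigma> \<le> d \<Longrightarrow> l \<le> deg \<sigma> \<Longrightarrow>
      PS \<sigma> = (\<Sum>\<tau>\<in>T B (deg \<sigma> - l). Q \<sigma> l \<tau> * PS \<tau>)"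
    and QQ: "1 \<in> QQ"
      "\<And>\<sigma> l \<tau>. stack \<sigma> \<Longrightarrow> Wt \<sigma> \<le> B \<Longrightarrow> deg \<sigma> \<le> d \<Longrightarrow> l \<le> deg \<sigma> \<Longrightarrow> l \<le> k \<Longrightarrow>
        \<tau> \<in> all_stacks d \<Longrightarrow> Q \<sigma> l \<tau> \<in> QQ"
  shows "stack \<sigma> \<Longrightarrow> Wt \<sigma> \<le> B \<Longrightarrow> deg \<sigma> \<le> d \<Longrightarrow> deg \<sigma> \<le> r * k \<Longrightarrow>
    \<exists>ps. PS \<sigma> = (\<Sum>p\<leftarrow>ps. prod_list p) \<and>
      (\<forall>p\<in>set ps. p \<noteq> [] \<and> length p \<le> r + 1 \<and> set p \<subseteq> QQ) \<and>
      length ps \<le> card (all_stacks d) ^ r"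
proof (induction r arbitrary: \<sigma>)
  case 0
  then have "\<sigma> = []"
    by (intro stack_deg_0) auto
  then show ?case
    \<comment> \<open>The empty stack yields the factor 1 rather than an empty product, because a
      multiplication gate must have an argument; this is the additional factor in
      \<open>r + 1\<close>.\<close>
    using QQ(1) by (intro exI[of _ "[[1]]"]) (auto simp: PS_def)
next
  case (Suc r)
  \<comment> \<open>The last round may find less than \<open>k\<close> units of degree left.\<close>
  define l where "l = min k (deg \<sigma>)"
  have l: "l \<le> deg \<sigma>" "l \<le> k" "deg \<sigma> - l \<le> r * k"
    using Suc.prems by (auto simp: l_def)
  let ?T = "T B (deg \<sigma> - l)"
  have T: "?T \<subseteq> all_stacks d"
    using Suc.prems by (intro T_subset) simp
  have "\<forall>\<tau>\<in>?T. \<exists>ps. PS \<tau> = (\<Sum>p\<leftarrow>ps. prod_list p) \<and>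
      (\<forall>p\<in>set ps. p \<noteq> [] \<and> length p \<le> r + 1 \<and> set p \<subseteq> QQ) \<and> length ps \<le> card (all_stacks d) ^ r"
    using Suc.prems l by (intro ballI Suc.IH) (auto simp: T_def)
  then obtain ps where ps: "\<And>\<tau>. \<tau> \<in> ?T \<Longrightarrow> PS \<tau> = (\<Sum>p\<leftarrow>ps \<tau>. prod_list p)"
    "\<And>\<tau> p. \<tau> \<in> ?T \<Longrightarrow> p \<in> set (ps \<tau>) \<Longrightarrow> p \<noteq> [] \<and> length p \<le> r + 1 \<and> set p \<subseteq> QQ"
    "\<And>\<tau>. \<tau> \<in> ?T \<Longrightarrow> length (ps \<tau>) \<le> card (all_stacks d) ^ r"
    by metis
  obtain ts where ts: "set ts = ?T" "distinct ts"
    using finite_distinct_list[OF finite_T] by blast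
  let ?f = "\<lambda>\<tau>. map (\<lambda>p. Q \<sigma> l \<tau> # p) (ps \<tau>)"
  have f: "sum_list (map prod_list (?f \<tau>)) = Q \<sigma> l \<tau> * PS \<tau>" if "\<tau> \<in> ?T" for \<tau>
    using that by (simp add: ps(1) comp_def sum_list_const_mult)
  have "(\<Sum>p\<leftarrow>concat (map ?f ts). prod_list p) = (\<Sum>\<tau>\<leftarrow>ts. sum_list (map prod_list (?f \<tau>)))"
    by (induction ts) auto
  also have "\<dots> = (\<Sum>\<tau>\<in>?T. sum_list (map prod_list (?f \<tau>)))"
    using ts by (simp add: sum_list_distinct_conv_sum_set)
  also have "\<dots> = (\<Sum>\<tau>\<in>?T. Q \<sigma> l \<tau> * PS \<tau>)"
    using f by (intro sum.cong) auto
  also have "\<dots> = PS \<sigma>"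
    using Suc.prems l by (intro Q[symmetric]) auto
  finally have "PS \<sigma> = (\<Sum>p\<leftarrow>concat (map ?f ts). prod_list p)"
    by simp
  moreover have "length (concat (map ?f ts)) \<le> card (all_stacks d) ^ Suc r"
  proof -
    have "length (concat (map ?f ts)) = (\<Sum>\<tau>\<leftarrow>ts. length (ps \<tau>))"
      by (simp add: length_concat comp_def)
    also have "\<dots> = (\<Sum>\<tau>\<in>?T. length (ps \<tau>))"
      using ts by (simp add: sum_list_distinct_conv_sum_set)
    also have "\<dots> \<le> (\<Sum>\<tau>\<in>?T. card (all_stacks d) ^ r)"
      using ps(3) by (intro sum_mono)
    also have "\<dots> \<le> card (all_stacks d) ^ Suc r"
      using card_mono[OF finite_all_stacks T] by simp
    finally show ?thesis .
  qed
  moreover have "p \<noteq> [] \<and> length p \<le> Suc r + 1 \<and> set p \<subseteq> QQ" if p: "p \<in> set (concat (map ?f ts))" for p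
  proof -
    obtain \<tau> p' where "\<tau> \<in> ?T" "p' \<in> set (ps \<tau>)" "p = Q \<sigma> l \<tau> # p'"
      using p ts(1) by auto
    moreover from this have "Q \<sigma> l \<tau> \<in> QQ"
      using Suc.prems l T by (intro QQ(2)) auto
    ultimately show ?thesis
      using ps(2)[of \<tau> p'] by auto
  qed
  ultimately show ?case by blast
qed

text \<open>The components of degree 1 to \<open>d\<close> are expanded separately, which gives the
  factor \<open>d\<close> in the number of products; \<open>k\<close> rounds suffice for each since
  \<open>d \<le> k * k\<close>. The square of \<open>S\<close> counts pairs of stacks, before and
  after a round.\<close>

lemma circuit_poly_sum_of_products:
  assumes V: "V = vars (circuit_poly C)" and d: "d = total_degree (circuit_poly C)"
    and k: "d \<le> k * k"
    and S: "S = (length C * (d + 1) + 1) ^ floorlog 2 d"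
  obtains QQ ps where "finite QQ" "card QQ \<le> 2 + (k + 1) * S ^ 2"
    "\<And>q. q \<in> QQ \<Longrightarrow> rep U k ((d + 2) ^ (length C * formal_degree C)) q"
    "ps \<noteq> []" "length ps \<le> 1 + d * S ^ k"
    "\<And>p. p \<in> set ps \<Longrightarrow> p \<noteq> [] \<and> length p \<le> k + 1 \<and> set p \<subseteq> QQ"
    "circuit_poly C = (\<Sum>p\<leftarrow>ps. prod_list p)"
proof -
  define out where "out = length C - 1"
  define B where "B = W out"
  define M where "M = d + 2"
  have out: "out < length C" and "out + 1 = length C"
    using last_gate by (auto simp: out_def)
  then have B: "B = length C * formal_degree C"
    by (simp only: B_def W_def formal_degree_eq out_def)
  have M: "2 \<le> M" and M_mono: "\<And>n. n \<le> B \<Longrightarrow> M ^ n \<le> M ^ B"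
    by (auto simp: M_def intro: power_increasing)
  \<comment> \<open>A coefficient family is chosen once for each \<sigma> and \<open>l\<close>. It
    does not depend on the product in which it is used, and this limits the number of different
    factors.\<close>
  define R where "R \<sigma> l Q \<longleftrightarrow> (stack \<sigma> \<longrightarrow> Wt \<sigma> \<le> B \<longrightarrow> deg \<sigma> \<le> d \<longrightarrow> l \<le> deg \<sigma> \<longrightarrow>
      (\<forall>\<tau>. rep U l (M ^ Wt \<sigma>) (Q \<tau>)) \<and> PS \<sigma> = (\<Sum>\<tau>\<in>T B (deg \<sigma> - l). Q \<tau> * PS \<tau>))" for \<sigma> l Q
  have R: "\<exists>Q. R \<sigma> l Q" for \<sigma> l
    using decomposes_stack[OF M, of \<sigma> B l] by (auto simp: M_def R_def decomposes_def)
  define Q where "Q \<sigma> l = (SOME Q. R \<sigma> l Q)" for \<sigma> l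
  have "R \<sigma> l (Q \<sigma> l)" for \<sigma> l
    unfolding Q_def using R by (rule someI_ex)
  then have Q: "(\<forall>\<tau>. rep U l (M ^ Wt \<sigma>) (Q \<sigma> l \<tau>)) \<and> PS \<sigma> = (\<Sum>\<tau>\<in>T B (deg \<sigma> - l). Q \<sigma> l \<tau> * PS \<tau>)"
    if "stack \<sigma>" "Wt \<sigma> \<le> B" "deg \<sigma> \<le> d" "l \<le> deg \<sigma>" for \<sigma> l
    using that unfolding R_def by blast
  define I where "I = {(\<sigma>, l, \<tau>). stack \<sigma> \<and> Wt \<sigma> \<le> B \<and> deg \<sigma> \<le> d \<and> l \<le> deg \<sigma> \<and> l \<le> k \<and> \<tau> \<in> all_stacks d}"
  obtain c where c: "H out 0 = const_poly c" "\<bar>c\<bar> \<le> 2 ^ B"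
    using H_0_const[OF out] by (auto simp: B_def)
  \<comment> \<open>The factor for the empty stack and the degree-0 component of the output account
    for the 2 in the bound.\<close>
  define QQ where "QQ = {1, const_poly c} \<union> (\<lambda>(\<sigma>, l, \<tau>). Q \<sigma> l \<tau>) ` I"
  let ?J = "all_stacks d \<times> {..k} \<times> all_stacks d"
  have I: "I \<subseteq> ?J" and finJ: "finite ?J"
    by (auto simp: I_def stack_subset_all_stacks finite_all_stacks)
  then have "finite I"
    by (rule finite_subset)
  have cardS: "card (all_stacks d) \<le> S"
    using card_all_stacks S by simp
  have "card I \<le> card ?J"
    using I finJ by (intro card_mono)
  also have "\<dots> = (k + 1) * (card (all_stacks d) * card (all_stacks d))"
    by (simp add: card_cartesian_product algebra_simps)
  also have "\<dots> \<le> (k + 1) * S ^ 2"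
    unfolding power2_eq_square using cardS by (intro mult_mono) auto
  finally have cardI: "card I \<le> (k + 1) * S ^ 2" .
  have "card QQ \<le> card {1, const_poly c :: 'v ipoly} + card ((\<lambda>(\<sigma>, l, \<tau>). Q \<sigma> l \<tau>) ` I)"
    unfolding QQ_def by (rule card_Un_le)
  also have "\<dots> \<le> 2 + card I"
    using \<open>finite I\<close> by (intro add_mono card_image_le) (auto simp: card_insert_if)
  finally have cardQQ: "card QQ \<le> 2 + (k + 1) * S ^ 2"
    using cardI by simp
  have repQQ: "rep U k (M ^ B) q" if "q \<in> QQ" for q
  proof -
    have "(2 :: int) ^ B \<le> int (M ^ B)"
      using M by (simp add: power_mono)
    then have "rep U k (M ^ B) (const_poly c)"
      using c(2) by (intro rep_const finite_U) linarith
    moreover have "rep U k (M ^ B) (const_poly 1)"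
      using M_mono[of 0] by (intro rep_const finite_U) (simp del: of_nat_power)
    moreover have "rep U k (M ^ B) (Q \<sigma> l \<tau>)" if "(\<sigma>, l, \<tau>) \<in> I" for \<sigma> l \<tau>
      using that Q[of \<sigma> l] M_mono[of "Wt \<sigma>"] rep_mono[OF finite_U, of l "M ^ Wt \<sigma>" "Q \<sigma> l \<tau>" k "M ^ B"]
      by (auto simp: I_def)
    ultimately show ?thesis
      using that by (auto simp: QQ_def)
  qed
  have "\<exists>ps. H out e = (\<Sum>p\<leftarrow>ps. prod_list p) \<and>
      (\<forall>p\<in>set ps. p \<noteq> [] \<and> length p \<le> k + 1 \<and> set p \<subseteq> QQ) \<and> length ps \<le> card (all_stacks d) ^ k"
    if "e \<in> {1..d}" for e
  proof -
    have "PS [(out, e)] = H out e"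
      by (simp add: PS_def)
    moreover have "\<exists>ps. PS [(out, e)] = (\<Sum>p\<leftarrow>ps. prod_list p) \<and>
      (\<forall>p\<in>set ps. p \<noteq> [] \<and> length p \<le> k + 1 \<and> set p \<subseteq> QQ) \<and> length ps \<le> card (all_stacks d) ^ k"
    proof (rule stack_sum_of_products[where Q = Q and B = B])
      show "PS \<sigma> = (\<Sum>\<tau>\<in>T B (deg \<sigma> - l). Q \<sigma> l \<tau> * PS \<tau>)"
        if "stack \<sigma>" "Wt \<sigma> \<le> B" "deg \<sigma> \<le> d" "l \<le> deg \<sigma>" for \<sigma> l
        using Q[OF that] by simp
      show "Q \<sigma> l \<tau> \<in> QQ"
        if "stack \<sigma>" "Wt \<sigma> \<le> B" "deg \<sigma> \<le> d" "l \<le> deg \<sigma>" "l \<le> k" "\<tau> \<in> all_stacks d" for \<sigma> l \<tau>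
      proof -
        have "(\<sigma>, l, \<tau>) \<in> I"
          using that by (simp add: I_def)
        then show ?thesis
          unfolding QQ_def by force
      qed
    qed (use that out k in \<open>auto simp: QQ_def stack_def Wt_def deg_def B_def\<close>)
    ultimately show ?thesis by simp
  qed
  then obtain ps where ps: "\<And>e. e \<in> {1..d} \<Longrightarrow> H out e = (\<Sum>p\<leftarrow>ps e. prod_list p)"
      "\<And>e p. e \<in> {1..d} \<Longrightarrow> p \<in> set (ps e) \<Longrightarrow> p \<noteq> [] \<and> length p \<le> k + 1 \<and> set p \<subseteq> QQ"
      "\<And>e. e \<in> {1..d} \<Longrightarrow> length (ps e) \<le> card (all_stacks d) ^ k"
    by metis
  \<comment> \<open>The degree-0 component cannot be put on a stack and enters as a product with a
    single factor; it also keeps the list nonempty when \<open>d = 0\<close>.\<close>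
  let ?ps = "[const_poly c] # concat (map ps [1..<Suc d])"
  have upt: "set [1..<Suc d] = {1..d}"
    by auto
  have "circuit_poly C = (\<Sum>e\<le>d. H out e)"
    using P_eq_sum_H[OF out] V d by (simp add: out_def circuit_poly_eq)
  also have "{..d} = insert 0 {1..d}"
    by auto
  also have "(\<Sum>e\<in>insert 0 {1..d}. H out e) = const_poly c + (\<Sum>e\<in>{1..d}. H out e)"
    by (simp add: c(1))
  also have "(\<Sum>e\<in>{1..d}. H out e) = (\<Sum>e\<in>{1..d}. sum_list (map prod_list (ps e)))"
    using ps(1) by (intro sum.cong) auto
  also have "\<dots> = (\<Sum>p\<leftarrow>concat (map ps [1..<Suc d]). prod_list p)"
    unfolding upt[symmetric] interv_sum_list_conv_sum_set_nat[symmetric]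
    by (simp add: sum_list_map_concat comp_def del: upt_Suc)
  finally have sum: "circuit_poly C = (\<Sum>p\<leftarrow>?ps. prod_list p)"
    by simp
  have "length (concat (map ps [1..<Suc d])) = (\<Sum>e\<in>{1..d}. length (ps e))"
    unfolding upt[symmetric] interv_sum_list_conv_sum_set_nat[symmetric]
    by (simp add: length_concat comp_def del: upt_Suc)
  also have "\<dots> \<le> (\<Sum>e\<in>{1..d}. S ^ k)"
    using cardS by (intro sum_mono order_trans[OF ps(3)] power_mono) auto
  finally have len: "length ?ps \<le> 1 + d * S ^ k"
    by simp
  have "p \<noteq> [] \<and> length p \<le> k + 1 \<and> set p \<subseteq> QQ" if p: "p \<in> set ?ps" for p
  proof (cases "p = [const_poly c]")
    case True
    then show ?thesis by (simp add: QQ_def)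
  next
    case False
    with p have "p \<in> set (concat (map ps [1..<Suc d]))"
      by (simp del: upt_Suc)
    then obtain e where "e \<in> set [1..<Suc d]" "p \<in> set (ps e)"
      by (auto simp del: upt_Suc set_upt)
    then have "e \<in> {1..d}" "p \<in> set (ps e)"
      unfolding upt by simp_all
    then show ?thesis by (rule ps(2))
  qed
  moreover have "finite QQ"
    using \<open>finite I\<close> by (simp add: QQ_def)
  ultimately show thesis
    using that[of QQ ?ps] cardQQ repQQ len sum by (simp add: B M_def)
qed

end

section \<open>Depth-four circuits and formulas for a constant-free circuit\<close>

lemma length_concat_le:
  assumes "\<And>xs. xs \<in> set xss \<Longrightarrow> length xs \<le> b"
  shows "length (concat xss) \<le> length xss * b"
  using assms by (induction xss) (auto intro: add_mono)

text \<open>The coefficient is an input of its own even for the empty word, so no term is empty, and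
  a word of length \<open>k\<close> gives fan-in \<open>k + 1\<close>.\<close>

definition word_term :: "('v list \<Rightarrow> int) \<Rightarrow> 'v list \<Rightarrow> 'v gate list" where
  "word_term c xs = Const (c xs) # map Var xs"

lemma term_value_word_term: "term_value (word_term c xs) = const_poly (c xs) * mon xs"
  by (simp add: term_value_def word_term_def mon_def comp_def)

definition depth_four_inputs :: "'v set \<Rightarrow> nat \<Rightarrow> 'v circuit \<Rightarrow> bool" where
  "depth_four_inputs V N C \<longleftrightarrow>
    (\<forall>v. Var v \<in> set C \<longrightarrow> v \<in> V) \<and> (\<forall>c. Const c \<in> set C \<longrightarrow> \<bar>c\<bar> \<le> int N)"

text \<open>Each factor is expanded into all words over the variables, at most \<open>L\<close> of
  them. The circuit has one addition gate per element of \<open>QQ\<close>, and the output gate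
  turns the 2 into a 3. The formula has a copy for each of the at most \<open>np * (k + 1)\<close>
  occurrences; the summands of its size count inputs, lower products, sums, upper products and the
  output.\<close>

lemma depth_four_of_constant_free:
  fixes C :: "'v circuit"
  assumes cf: "constant_free C" and d: "d = total_degree (circuit_poly C)" and k: "d \<le> k * k"
    and S: "S = (length C * (d + 1) + 1) ^ floorlog 2 d"
    and N: "N = (d + 2) ^ (length C * formal_degree C)"
    and np: "np = 1 + d * S ^ k" and L: "L = (length C + 1) ^ k"
  shows "\<exists>G. depth_four_circuit G \<and> circuit_poly G = circuit_poly C \<and>
      num_add_gates G \<le> 3 + (k + 1) * S ^ 2 \<and>
      num_mul_gates G \<le> (2 + (k + 1) * S ^ 2) * L + np \<and>
      mul_fan_in_le G (real (k + 1)) \<and> depth_four_inputs (vars (circuit_poly C)) N G"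
    and "\<exists>F. depth_four_formula F \<and> circuit_poly F = circuit_poly C \<and>
      circuit_size F \<le> np * (k + 1) * L * (k + 1) + np * (k + 1) * L + np * (k + 1) + np + 1 \<and>
      mul_fan_in_le F (real (k + 1)) \<and> depth_four_inputs (vars (circuit_poly C)) N F"
proof -
  interpret cf_circuit C "vars (circuit_poly C)"
    using cf by unfold_locales
  obtain QQ ps where QQ: "finite QQ" "card QQ \<le> 2 + (k + 1) * S ^ 2" "\<And>q. q \<in> QQ \<Longrightarrow> rep U k N q"
    and ps: "ps \<noteq> []" "length ps \<le> np"
      "\<And>p. p \<in> set ps \<Longrightarrow> p \<noteq> [] \<and> length p \<le> k + 1 \<and> set p \<subseteq> QQ"
      "circuit_poly C = (\<Sum>p\<leftarrow>ps. prod_list p)"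
    using circuit_poly_sum_of_products[OF refl d k S] unfolding N np by metis
  have "\<forall>q\<in>QQ. \<exists>c. (\<forall>xs. \<bar>c xs\<bar> \<le> int N) \<and>
      q = (\<Sum>xs\<in>var_lists U k. const_poly (c xs) * mon xs)"
    using QQ(3) by (simp add: rep_def)
  then obtain c where c: "\<And>q xs. q \<in> QQ \<Longrightarrow> \<bar>c q xs\<bar> \<le> int N"
    "\<And>q. q \<in> QQ \<Longrightarrow> (\<Sum>xs\<in>var_lists U k. const_poly (c q xs) * mon xs) = q"
    by metis
  obtain ll where ll: "set ll = var_lists U k" "distinct ll"
    using finite_distinct_list[OF finite_var_lists[OF finite_U]] by blast
  have "length ll = card (var_lists U k)"
    using distinct_card[OF ll(2)] ll(1) by simp
  also have "\<dots> \<le> (card U + 1) ^ k"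
    unfolding var_lists_def by (rule card_lists_le[OF finite_U])
  also have "\<dots> \<le> L"
    unfolding L using card_U by (intro power_mono) auto
  finally have len_ll: "length ll \<le> L" .
  define terms where "terms q = map (word_term (c q)) ll" for q
  have val: "sum_value (terms q) = q" if "q \<in> QQ" for q
  proof -
    have "sum_value (terms q) = (\<Sum>xs\<leftarrow>ll. const_poly (c q xs) * mon xs)"
      by (simp add: sum_value_def terms_def comp_def term_value_word_term)
    also have "\<dots> = q"
      using c(2)[OF that] ll by (simp add: sum_list_distinct_conv_sum_set)
    finally show ?thesis .
  qed
  have terms_input: "is_input u" if "t \<in> set (terms q)" "u \<in> set t" for q t u
    using that by (auto simp: terms_def word_term_def)
  have terms_nonempty: "terms q \<noteq> []" "[] \<notin> set (terms q)" for q
    using ll(1) Nil_in_var_lists[of U k] by (auto simp: terms_def word_term_def)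
  have terms_length: "length t \<le> k + 1" if "t \<in> set (terms q)" for t q
    using that ll(1) by (auto simp: terms_def word_term_def var_lists_def)
  have terms_Var: "v \<in> vars (circuit_poly C)" if "t \<in> set (terms q)" "Var v \<in> set t" for q t v
    using that ll(1) by (auto simp: terms_def word_term_def var_lists_def U_def)
  have terms_Const: "\<bar>a\<bar> \<le> int N" if "t \<in> set (terms q)" "Const a \<in> set t" "q \<in> QQ" for q t a
    using that c(1) by (auto simp: terms_def word_term_def)
  have prods: "(\<Sum>p\<leftarrow>ps. \<Prod>q\<leftarrow>p. sum_value (terms q)) = circuit_poly C"
  proof -
    have "(\<Prod>q\<leftarrow>p. sum_value (terms q)) = prod_list p" if "p \<in> set ps" for p
    proof -
      have "map (\<lambda>q. sum_value (terms q)) p = map id p"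
        using ps(3)[OF that] val by (intro map_cong) auto
      then show ?thesis by simp
    qed
    then show ?thesis
      unfolding ps(4) by (intro arg_cong[where f = sum_list] map_cong) auto
  qed
  show "\<exists>G. depth_four_circuit G \<and> circuit_poly G = circuit_poly C \<and>
      num_add_gates G \<le> 3 + (k + 1) * S ^ 2 \<and>
      num_mul_gates G \<le> (2 + (k + 1) * S ^ 2) * L + np \<and>
      mul_fan_in_le G (real (k + 1)) \<and> depth_four_inputs (vars (circuit_poly C)) N G"
  proof -
    obtain ql where ql: "set ql = QQ" "distinct ql"
      using finite_distinct_list[OF QQ(1)] by blast
    have len_ql: "length ql \<le> 2 + (k + 1) * S ^ 2"
      using distinct_card[OF ql(2)] ql(1) QQ(2) by simp
    \<comment> \<open>Sharing: every occurrence of a factor is wired to the one position of its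
      addition gate.\<close>
    have "\<forall>q\<in>QQ. \<exists>j. j < length ql \<and> ql ! j = q"
      using ql(1) by (auto simp: in_set_conv_nth)
    then obtain idx where idx: "\<And>q. q \<in> QQ \<Longrightarrow> idx q < length ql \<and> ql ! idx q = q"
      by metis
    let ?qs = "map terms ql" and ?ps = "map (map idx) ps"
    interpret layers ?qs ?ps
    proof
      show "is_input u" if "q \<in> set ?qs" "t \<in> set q" "u \<in> set t" for q t u
        using that terms_input by auto
      show "[] \<notin> set ?qs"
        using terms_nonempty(1) by (metis ex_map_conv)
      show "[] \<notin> set q" if "q \<in> set ?qs" for q
        using that terms_nonempty(2) by auto
      show "?ps \<noteq> []" "[] \<notin> set ?ps"
        using ps(1,3) by auto
      show "j < length ?qs" if "p \<in> set ?ps" "j \<in> set p" for p j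
        using that ps(3) idx by fastforce
    qed
    have "(\<Prod>j\<leftarrow>map idx p. sum_value (?qs ! j)) = (\<Prod>q\<leftarrow>p. sum_value (terms q))" if "p \<in> set ps" for p
    proof -
      have "map (\<lambda>q. sum_value (?qs ! idx q)) p = map (\<lambda>q. sum_value (terms q)) p"
        using ps(3)[OF that] idx by (intro map_cong) (auto simp: subset_iff)
      then show ?thesis by (simp only: map_map comp_def)
    qed
    then have "map (\<lambda>p. \<Prod>j\<leftarrow>p. sum_value (?qs ! j)) ?ps = map (\<lambda>p. \<Prod>q\<leftarrow>p. sum_value (terms q)) ps"
      unfolding map_map comp_def by (intro map_cong) auto
    then have "circuit_poly (four_layers ?qs ?ps) = circuit_poly C"
      unfolding circuit_poly_four_layers prods[symmetric] by (rule arg_cong)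
    moreover have "num_add_gates (four_layers ?qs ?ps) \<le> 3 + (k + 1) * S ^ 2"
      using len_ql by (simp add: num_add_gates_four_layers)
    moreover have "num_mul_gates (four_layers ?qs ?ps) \<le> (2 + (k + 1) * S ^ 2) * L + np"
    proof -
      have "length (concat ?qs) \<le> length ?qs * L"
        using len_ll by (intro length_concat_le) (auto simp: terms_def)
      also have "\<dots> \<le> (2 + (k + 1) * S ^ 2) * L"
        using len_ql by (intro mult_right_mono) auto
      finally show ?thesis
        using ps(2) by (simp add: num_mul_gates_four_layers)
    qed
    moreover have "mul_fan_in_le (four_layers ?qs ?ps) (real (k + 1))"
      using terms_length ps(3) by (intro mul_fan_in_four_layers) (auto simp flip: of_nat_Suc)
    moreover have "depth_four_inputs (vars (circuit_poly C)) N (four_layers ?qs ?ps)"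
      unfolding depth_four_inputs_def
    proof (intro conjI allI impI)
      fix v assume "Var v \<in> set (four_layers ?qs ?ps)"
      then show "v \<in> vars (circuit_poly C)"
        using input_in_four_layers[of "Var v"] terms_Var by auto
    next
      fix a assume "Const a \<in> set (four_layers ?qs ?ps)"
      then show "\<bar>a\<bar> \<le> int N"
        using input_in_four_layers[of "Const a"] terms_Const ql(1) by auto
    qed
    ultimately show ?thesis
      using depth_four_circuit_four_layers by blast
  qed
  show "\<exists>F. depth_four_formula F \<and> circuit_poly F = circuit_poly C \<and>
      circuit_size F \<le> np * (k + 1) * L * (k + 1) + np * (k + 1) * L + np * (k + 1) + np + 1 \<and>
      mul_fan_in_le F (real (k + 1)) \<and> depth_four_inputs (vars (circuit_poly C)) N F"
  proof -
    \<comment> \<open>No sharing: the factors of all products are laid out one after another, and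
      \<open>blocks\<close> wires each product to its own stretch.\<close>
    let ?ns = "map (map terms) ps"
    let ?qs = "concat ?ns" and ?ps = "blocks 0 ?ns"
    have qs_in: "\<exists>q'\<in>QQ. q = terms q'" if "q \<in> set ?qs" for q
      using that ps(3) by fastforce
    interpret layers ?qs ?ps
    proof
      show "is_input u" if "q \<in> set ?qs" "t \<in> set q" "u \<in> set t" for q t u
        using that qs_in terms_input by blast
      show "[] \<notin> set ?qs"
        using qs_in terms_nonempty(1) by metis
      show "[] \<notin> set q" if "q \<in> set ?qs" for q
        using that qs_in terms_nonempty(2) by blast
      show "?ps \<noteq> []"
        using ps(1) length_blocks[of 0 ?ns] by (metis length_0_conv map_is_Nil_conv)
      show "[] \<notin> set ?ps"
        using blocks_nonempty[of "[]" 0 ?ns] ps(3) by auto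
      show "j < length ?qs" if "p \<in> set ?ps" "j \<in> set p" for p j
        using set_blocks_bounds[OF that] by simp
    qed
    have "map (\<lambda>p. map (\<lambda>j. sum_value (?qs ! j)) p) ?ps = map (map sum_value) ?ns"
    proof -
      have "map (\<lambda>p. map (\<lambda>j. sum_value (?qs ! j)) p) ?ps =
          map (map (\<lambda>j. ([] @ map sum_value ?qs) ! j)) (blocks (length ([] :: 'v ipoly list)) ?ns)"
      proof (simp only: list.size append_Nil, intro map_cong refl)
        fix p j assume "p \<in> set ?ps" "j \<in> set p"
        then have "j < length ?qs"
          by (rule prods_bound)
        then show "sum_value (?qs ! j) = map sum_value ?qs ! j"
          by (simp only: nth_map)
      qed
      then show ?thesis
        unfolding map_nth_map_blocks .
    qed
    then have "map prod_list (map (\<lambda>p. map (\<lambda>j. sum_value (?qs ! j)) p) ?ps) = map prod_list (map (map sum_value) ?ns)"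
      by (rule arg_cong)
    then have "map (\<lambda>p. \<Prod>j\<leftarrow>p. sum_value (?qs ! j)) ?ps = map (\<lambda>p. \<Prod>q\<leftarrow>p. sum_value (terms q)) ps"
      by (simp add: comp_def)
    then have "circuit_poly (four_layers ?qs ?ps) = circuit_poly C"
      unfolding circuit_poly_four_layers prods[symmetric] by (rule arg_cong)
    moreover have "circuit_size (four_layers ?qs ?ps) \<le>
        np * (k + 1) * L * (k + 1) + np * (k + 1) * L + np * (k + 1) + np + 1"
    proof -
      have "length ?qs \<le> length ?ns * (k + 1)"
        using ps(3) by (intro length_concat_le) auto
      also have "\<dots> \<le> np * (k + 1)"
        using ps(2) by (intro mult_right_mono) auto
      finally have q: "length ?qs \<le> np * (k + 1)" .
      have "length (concat ?qs) \<le> length ?qs * L"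
        by (rule length_concat_le) (use qs_in len_ll in \<open>force simp: terms_def\<close>)
      also have "\<dots> \<le> np * (k + 1) * L"
        using q by (intro mult_right_mono) auto
      finally have t: "length (concat ?qs) \<le> np * (k + 1) * L" .
      have "length (concat (concat ?qs)) \<le> length (concat ?qs) * (k + 1)"
        by (rule length_concat_le) (use qs_in terms_length in force)
      also have "\<dots> \<le> np * (k + 1) * L * (k + 1)"
        using t by (intro mult_right_mono) auto
      finally have "length (concat (concat ?qs)) \<le> np * (k + 1) * L * (k + 1)" .
      moreover have "length ?ps \<le> np"
        using ps(2) by simp
      ultimately show ?thesis
        unfolding circuit_size_def length_four_layers using q t by linarith
    qed
    moreover have "mul_fan_in_le (four_layers ?qs ?ps) (real (k + 1))"
    proof (rule mul_fan_in_four_layers)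
      show "real (length t) \<le> real (k + 1)" if "q \<in> set ?qs" "t \<in> set q" for q t
        using that qs_in terms_length by (metis of_nat_mono)
      show "real (length p) \<le> real (k + 1)" if "p \<in> set ?ps" for p
        using length_blocks_elem[OF that] ps(3) by (auto simp flip: of_nat_Suc)
    qed
    moreover have "depth_four_inputs (vars (circuit_poly C)) N (four_layers ?qs ?ps)"
      unfolding depth_four_inputs_def
    proof (intro conjI allI impI)
      fix v assume "Var v \<in> set (four_layers ?qs ?ps)"
      then obtain q t where "q \<in> set ?qs" "t \<in> set q" "Var v \<in> set t"
        using input_in_four_layers[of "Var v"] by auto
      then show "v \<in> vars (circuit_poly C)"
        using qs_in terms_Var by metis
    next
      fix a assume "Const a \<in> set (four_layers ?qs ?ps)"
      then obtain q t where "q \<in> set ?qs" "t \<in> set q" "Const a \<in> set t"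
        using input_in_four_layers[of "Const a"] by auto
      then show "\<bar>a\<bar> \<le> int N"
        using qs_in terms_Const by metis
    qed
    moreover have "depth_four_formula (four_layers ?qs ?ps)"
      by (rule depth_four_formula_four_layers) (simp only: concat_blocks add_0)
    ultimately show ?thesis by blast
  qed
qed

section \<open>Growth rates\<close>

text \<open>For \<open>d > 0\<close> take the least \<open>k\<close> with
  \<open>d \<le> k * k\<close> and write \<open>k = l + 1\<close>. Then \<open>l * l < d\<close> and
  \<open>l \<le> l * l\<close>, so \<open>k * k = l * l + 2 * l + 1\<close> is at most
  \<open>3 * (l * l) + 1\<close>, hence at most \<open>3 * d\<close>. This is the origin of the 3
  under the square root.\<close>

lemma exists_square_between: "\<exists>k. d \<le> k * k \<and> k * k \<le> 3 * (d :: nat)"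
proof (cases "d = 0")
  case False
  define k where "k = (LEAST k. d \<le> k * k)"
  have k: "d \<le> k * k"
    unfolding k_def by (rule LeastI[of _ d]) simp
  then obtain l where l: "k = Suc l"
    using False by (cases k) auto
  have "\<not> d \<le> l * l"
    using not_less_Least[of l "\<lambda>k. d \<le> k * k"] l by (simp add: k_def)
  moreover have "l \<le> l * l"
    by (cases l) auto
  ultimately have "k * k \<le> 3 * d"
    by (simp only: l mult_Suc mult_Suc_right)
  with k show ?thesis by blast
qed auto

lemma poly_le_power: "\<exists>b. \<forall>n\<ge>2. poly (p :: nat poly) n \<le> n ^ b"
proof (induction p)
  case (pCons a p)
  then obtain b where b: "\<And>n. n \<ge> 2 \<Longrightarrow> poly p n \<le> n ^ b"
    by blast
  have "poly (pCons a p) n \<le> n ^ (a + b + 2)" if "n \<ge> 2" for n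
  proof -
    have "a \<le> 2 ^ a"
      by (rule less_imp_le) (rule less_exp)
    also have "\<dots> \<le> n ^ a"
      using that by (rule power_mono) simp
    also have "\<dots> \<le> n ^ (a + b + 1)"
      using that by (intro power_increasing) auto
    finally have "a \<le> n ^ (a + b + 1)" .
    moreover have "n * poly p n \<le> n ^ Suc b"
      using b[OF that] by simp
    moreover have "n ^ Suc b \<le> n ^ (a + b + 1)"
      using that by (intro power_increasing) auto
    ultimately have "poly (pCons a p) n \<le> 2 * n ^ (a + b + 1)"
      unfolding poly_pCons by linarith
    also have "\<dots> \<le> n * n ^ (a + b + 1)"
      using that by (intro mult_right_mono) auto
    finally show ?thesis by simp
  qed
  then show ?case by blast
qed auto

lemma n_pow_OI:
  assumes h: "\<And>n. n \<ge> 2 \<Longrightarrow> h n \<le> n ^ (c * E n)"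
    and E: "\<And>n. real (E n) \<le> K * max 1 (g n)"
  shows "n_pow_O h g"
  unfolding n_pow_O_def
proof (intro exI[of _ "\<lambda>n. real (c * E n)"] conjI)
  have "norm (real (c * E n)) \<le> (real c * K) * norm (max 1 (g n))" for n
    using mult_left_mono[OF E, of "real c" n] by (simp add: mult.assoc)
  then show "(\<lambda>n. real (c * E n)) \<in> O(\<lambda>n. max 1 (g n))"
    by (intro bigoI[of _ "real c * K"] always_eventually) simp
  have "real (h n) \<le> real n powr real (c * E n)" if "n \<ge> 2" for n
  proof -
    have "real (h n) \<le> real (n ^ (c * E n))"
      using h[OF that] by (rule of_nat_mono)
    also have "\<dots> = real n powr real (c * E n)"
      using that by (simp only: of_nat_power) (rule powr_realpow[symmetric], simp)
    finally show ?thesis .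
  qed
  then show "\<forall>\<^sub>F n in sequentially. real (h n) \<le> real n powr real (c * E n)"
    by (auto intro: eventually_sequentiallyI[of 2])
qed

lemma floorlog_le_log: "real (floorlog 2 d) \<le> max 0 (log 2 (real d)) + 1"
proof (cases "d = 0")
  case False
  then have "0 \<le> log 2 (real d)"
    by simp
  then show ?thesis
    using False by (simp add: floorlog_def)
qed (simp add: floorlog_def)

lemma log_exponent: "real (floorlog 2 d + 1) \<le> 3 * max 1 (log 2 (real d))"
  using floorlog_le_log[of d] by (simp add: max_def split: if_splits)

text \<open>For \<open>d \<le> 1\<close> the left side is at most 4. Otherwise \<open>sqrt d\<close>
  and \<open>log 2 d\<close> are at least 1, and the two factors are at most
  \<open>3 * log 2 d\<close> and \<open>3 * sqrt d\<close>, whence 9.\<close>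

lemma sqrt_log_exponent:
  assumes "k * k \<le> 3 * d"
  shows "real ((floorlog 2 d + 1) * (k + 1)) \<le> 9 * max 1 (sqrt (real d) * log 2 (real d))"
proof (cases "d \<le> 1")
  case True
  have "k < 2"
  proof (rule ccontr)
    assume "\<not> k < 2"
    then have "2 * 2 \<le> k * k"
      by (intro mult_mono) auto
    with assms True show False by simp
  qed
  moreover have "floorlog 2 d \<le> 1"
    using True by (intro floorlog_leI) auto
  ultimately have "(floorlog 2 d + 1) * (k + 1) \<le> 2 * 2"
    by (intro mult_mono) auto
  then have "real ((floorlog 2 d + 1) * (k + 1)) \<le> 9 * 1"
    by linarith
  also have "\<dots> \<le> 9 * max 1 (sqrt (real d) * log 2 (real d))"
    by (intro mult_left_mono) auto
  finally show ?thesis .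
next
  case False
  then have d: "1 \<le> sqrt (real d)" "1 \<le> log 2 (real d)"
    by (auto simp: le_log_iff)
  have "real k ^ 2 \<le> (2 * sqrt (real d)) ^ 2"
  proof -
    have "real k ^ 2 = real (k * k)"
      by (simp add: power2_eq_square)
    also have "\<dots> \<le> real (4 * d)"
      using assms by linarith
    also have "\<dots> = (2 * sqrt (real d)) ^ 2"
      by (simp add: power_mult_distrib)
    finally show ?thesis .
  qed
  then have "real k \<le> 2 * sqrt (real d)"
    by (rule power2_le_imp_le) simp
  then have "real (k + 1) \<le> 3 * sqrt (real d)"
    using d(1) by linarith
  moreover have "real (floorlog 2 d + 1) \<le> 3 * log 2 (real d)"
    using log_exponent[of d] d by (simp add: max_def split: if_splits)
  ultimately have "real (floorlog 2 d + 1) * real (k + 1) \<le> (3 * log 2 (real d)) * (3 * sqrt (real d))"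
    by (intro mult_mono) auto
  also have "\<dots> = 9 * (sqrt (real d) * log 2 (real d))"
    by simp
  also have "\<dots> \<le> 9 * max 1 (sqrt (real d) * log 2 (real d))"
    by simp
  finally show ?thesis
    by (simp only: of_nat_mult)
qed

section \<open>Numerical bounds on gates and bit sizes\<close>

lemma gate_bounds:
  fixes m :: nat
  assumes s: "s \<le> m" and d: "d \<le> m" and k: "k * k \<le> 3 * d"
    and S: "S = (s * (d + 1) + 1) ^ l" and np: "np = 1 + d * S ^ k" and L: "L = (s + 1) ^ k"
  shows "3 + (k + 1) * S ^ 2 \<le> (m + 2) ^ (4 * (l + 1))"
    and "(2 + (k + 1) * S ^ 2) * L + np \<le> (m + 2) ^ (6 * ((l + 1) * (k + 1)))"
    and "np * (k + 1) * L * (k + 1) + np * (k + 1) * L + np * (k + 1) + np + 1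
      \<le> (m + 2) ^ (10 * ((l + 1) * (k + 1)))"
proof -
  \<comment> \<open>The base is at least 2, so numerical factors turn into exponents. The exponents
    are generous: what matters is that they are linear in \<open>l + 1\<close> or in
    \<open>(l + 1) * (k + 1)\<close>.\<close>
  define X where "X = m + 2"
  define e where "e = (l + 1) * (k + 1)"
  have pow: "X ^ i \<le> X ^ j" if "i \<le> j" for i j
    using that by (intro power_increasing) (auto simp: X_def)
  have pos: "1 \<le> X ^ i" for i
    using pow[of 0 i] by simp
  have e: "1 \<le> e" "l + 1 \<le> e" "k + 1 \<le> e" "l * k + 1 \<le> e"
    by (auto simp: e_def)
  have "s * (d + 1) + 1 \<le> m * (m + 1) + 1"
    using s d by (intro add_mono mult_mono) auto
  also have "\<dots> \<le> X ^ 2"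
    by (simp add: X_def power2_eq_square)
  finally have "S \<le> (X ^ 2) ^ l"
    unfolding S by (rule power_mono) simp
  then have S_le: "S \<le> X ^ (2 * l)"
    by (simp only: power_mult)
  have "S ^ 2 \<le> (X ^ (2 * l)) ^ 2" "S ^ k \<le> (X ^ (2 * l)) ^ k"
    using S_le by (auto intro: power_mono)
  then have S2: "S ^ 2 \<le> X ^ (4 * l)" and Sk: "S ^ k \<le> X ^ (2 * l * k)"
    by (simp_all flip: power_mult)
  \<comment> \<open>For the addition gates \<open>k + 1\<close> must stay below a fixed power of
    \<open>X\<close>; a bound such as \<open>X ^ (k + 1)\<close> would bring the square root into
    their exponent.\<close>
  have "k \<le> k * k"
    by (cases k) auto
  then have "k + 1 \<le> 3 * m + 1"
    using k d by linarith
  also have "\<dots> \<le> X ^ 2"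
    by (simp add: X_def power2_eq_square)
  finally have k1: "k + 1 \<le> X ^ 2" .
  have mult_le: "x * y \<le> X ^ n" if "x \<le> X ^ i" "y \<le> X ^ j" "i + j = n" for x y i j n
    unfolding that(3)[symmetric] power_add using that(1,2) by (rule mult_mono) auto
  have kS: "(k + 1) * S ^ 2 \<le> X ^ (4 * l + 2)"
    using k1 S2 by (rule mult_le) simp
  have X2: "4 \<le> X ^ 2" "2 \<le> X" "8 \<le> X ^ 3"
    using power_mono[of 2 X 2] power_mono[of 2 X 3] by (auto simp: X_def)
  have add: "3 + (k + 1) * S ^ 2 \<le> X ^ (4 * (l + 1))"
  proof -
    have "3 + (k + 1) * S ^ 2 \<le> 4 * X ^ (4 * l + 2)"
      using kS pos[of "4 * l + 2"] by linarith
    also have "\<dots> \<le> X ^ 2 * X ^ (4 * l + 2)"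
      using X2 by (intro mult_right_mono) auto
    also have "\<dots> = X ^ (4 * (l + 1))"
      unfolding power_add[symmetric] by (rule arg_cong[where f = "\<lambda>i. X ^ i"]) simp
    finally show ?thesis .
  qed
  then show "3 + (k + 1) * S ^ 2 \<le> (m + 2) ^ (4 * (l + 1))"
    by (simp add: X_def)
  have "L \<le> X ^ k"
    unfolding L X_def using s by (intro power_mono) auto
  also have "\<dots> \<le> X ^ e"
    using e by (intro pow) auto
  finally have L_le: "L \<le> X ^ e" .
  have "d * S ^ k \<le> X * X ^ (2 * l * k)"
    using d Sk by (intro mult_mono) (auto simp: X_def)
  then have "np \<le> 1 + X ^ (2 * l * k + 1)"
    by (simp add: np)
  also have "\<dots> \<le> 2 * X ^ (2 * l * k + 1)"
    using pos[of "2 * l * k + 1"] by linarith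
  also have "\<dots> \<le> X * X ^ (2 * l * k + 1)"
    using X2 by (intro mult_right_mono) auto
  also have "\<dots> = X ^ (2 * (l * k + 1))"
    by (simp add: mult.assoc)
  also have "\<dots> \<le> X ^ (2 * e)"
    using e by (intro pow) auto
  finally have np_le: "np \<le> X ^ (2 * e)" .
  have e5: "X ^ (2 * e) \<le> X ^ (5 * e)" "X ^ (3 * e) \<le> X ^ (5 * e)" "X ^ (4 * e) \<le> X ^ (5 * e)"
    by (auto intro: pow)
  have "2 + (k + 1) * S ^ 2 \<le> X ^ (4 * e)"
    using add pow[OF mult_le_mono2[OF e(2)], of 4] by linarith
  then have "(2 + (k + 1) * S ^ 2) * L \<le> X ^ (5 * e)"
    using L_le by (rule mult_le) simp
  then have "(2 + (k + 1) * S ^ 2) * L + np \<le> 2 * X ^ (5 * e)"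
    using np_le e5(1) by linarith
  also have "\<dots> \<le> X * X ^ (5 * e)"
    using X2 by (intro mult_right_mono) auto
  also have "\<dots> \<le> X ^ (6 * e)"
    using pow[of "Suc (5 * e)" "6 * e"] e by simp
  finally show "(2 + (k + 1) * S ^ 2) * L + np \<le> (m + 2) ^ (6 * ((l + 1) * (k + 1)))"
    by (simp add: X_def e_def)
  have k1e: "k + 1 \<le> X ^ e"
  proof -
    have "k + 1 \<le> 2 ^ (k + 1)"
      by (rule less_imp_le) (rule less_exp)
    also have "\<dots> \<le> X ^ (k + 1)"
      using X2 by (rule_tac power_mono) auto
    also have "\<dots> \<le> X ^ e"
      using e by (intro pow) auto
    finally show ?thesis .
  qed
  have b1: "np * (k + 1) \<le> X ^ (3 * e)"
    using np_le k1e by (rule mult_le) simp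
  have b2: "np * (k + 1) * L \<le> X ^ (4 * e)"
    using b1 L_le by (rule mult_le) simp
  have b3: "np * (k + 1) * L * (k + 1) \<le> X ^ (5 * e)"
    using b2 k1e by (rule mult_le) simp
  \<comment> \<open>Five summands, rounded up to 8 so that the factor fits into
    \<open>X ^ 3\<close>.\<close>
  have "np * (k + 1) * L * (k + 1) + np * (k + 1) * L + np * (k + 1) + np + 1 \<le> 8 * X ^ (5 * e)"
    using b1 b2 b3 np_le e5 pos[of "5 * e"] by linarith
  also have "\<dots> \<le> X ^ 3 * X ^ (5 * e)"
    using X2 by (intro mult_right_mono) auto
  also have "\<dots> \<le> X ^ (10 * e)"
    using pow[of "3 + 5 * e" "10 * e"] e by (simp add: power_add)
  finally show "np * (k + 1) * L * (k + 1) + np * (k + 1) * L + np * (k + 1) + np + 1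
      \<le> (m + 2) ^ (10 * ((l + 1) * (k + 1)))"
    by (simp add: X_def e_def)
qed

text \<open>Replacing the base by \<open>2 ^ (d + 2)\<close> gives an exponent that is a product of
  the given quantities; the final 1 makes the inequality strict.\<close>

lemma floorlog_power_bound:
  assumes "nat \<bar>c\<bar> \<le> (d + 2) ^ n"
  shows "floorlog 2 (nat \<bar>c\<bar>) \<le> (d + 2) * n + 1"
proof (rule floorlog_leI)
  have "nat \<bar>c\<bar> \<le> (2 ^ (d + 2)) ^ n"
    by (rule order_trans[OF assms], rule power_mono, rule less_imp_le, rule less_exp) simp
  also have "\<dots> < 2 ^ ((d + 2) * n + 1)"
    unfolding power_mult[symmetric] by (rule power_strict_increasing) auto
  finally show "nat \<bar>c\<bar> < 2 ^ ((d + 2) * n + 1)" .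
qed auto

lemma mul_fan_in_le_mono: "mul_fan_in_le C a \<Longrightarrow> a \<le> b \<Longrightarrow> mul_fan_in_le C b"
  unfolding mul_fan_in_le_def by (meson order_trans)

lemma poly_size_inputsI:
  fixes p :: "nat poly"
  assumes "\<And>n. depth_four_inputs (vars (f n)) ((d n + 2) ^ (s n * D n)) (C n)"
    and "\<And>n. d n \<le> poly p n" "\<And>n. s n \<le> poly p n" "\<And>n. D n \<le> poly p n"
  shows "poly_size_inputs f C"
  unfolding poly_size_inputs_def
proof (intro conjI exI[of _ "(p + [:2:]) * (p * p) + 1"] allI impI)
  show "v \<in> vars (f n)" if "Var v \<in> set (C n)" for n v
    using assms(1) that by (auto simp: depth_four_inputs_def)
next
  fix n c assume "Const c \<in> set (C n)"
  then have "\<bar>c\<bar> \<le> int ((d n + 2) ^ (s n * D n))"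
    using assms(1) by (auto simp only: depth_four_inputs_def)
  then have "floorlog 2 (nat \<bar>c\<bar>) \<le> (d n + 2) * (s n * D n) + 1"
    by (intro floorlog_power_bound) linarith
  also have "\<dots> \<le> (poly p n + 2) * (poly p n * poly p n) + 1"
    using assms(2-4) by (intro add_mono mult_mono) auto
  finally show "floorlog 2 (nat \<bar>c\<bar>) \<le> poly ((p + [:2:]) * (p * p) + 1) n"
    by simp
qed

theorem theorem6:
  fixes f :: "nat \<Rightarrow> 'v ipoly" and d :: "nat \<Rightarrow> nat"
  assumes "f \<in> VP0"
    and "\<And>n. d n = total_degree (f n)"
  shows "(\<exists>\<Gamma> :: nat \<Rightarrow> 'v circuit.
            (\<forall>n. depth_four_circuit (\<Gamma> n) \<and> circuit_poly (\<Gamma> n) = f n) \<and>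
            n_pow_O (\<lambda>n. num_add_gates (\<Gamma> n)) (\<lambda>n. log 2 (d n)) \<and>
            n_pow_O (\<lambda>n. num_mul_gates (\<Gamma> n)) (\<lambda>n. sqrt (d n) * log 2 (d n)) \<and>
            poly_size_inputs f \<Gamma> \<and>
            (\<forall>n. mul_fan_in_le (\<Gamma> n) (sqrt (3 * d n) + 1)))
       \<and> (\<exists>F :: nat \<Rightarrow> 'v circuit.
            (\<forall>n. depth_four_formula (F n) \<and> circuit_poly (F n) = f n) \<and>
            n_pow_O (\<lambda>n. circuit_size (F n)) (\<lambda>n. sqrt (d n) * log 2 (d n)) \<and>
            poly_size_inputs f F \<and>
            (\<forall>n. mul_fan_in_le (F n) (sqrt (3 * d n) + 1)))"
proof -
  obtain p :: "nat poly" and C where C: "\<And>n. constant_free (C n)" "\<And>n. circuit_poly (C n) = f n"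
      "\<And>n. length (C n) \<le> poly p n" "\<And>n. formal_degree (C n) \<le> poly p n"
    using assms(1) by (auto simp: VP0_def circuit_size_def)
  have d_eq: "d n = total_degree (circuit_poly (C n))" for n
    by (simp add: C(2) assms(2))
  \<comment> \<open>Membership in \<open>VP0\<close> bounds the formal degree, and through it the
    actual degree.\<close>
  have d_le: "d n \<le> poly p n" for n
    using cf_circuit.total_degree_le_formal_degree[OF cf_circuit.intro[OF C(1)]] C(4)
    unfolding d_eq by (rule order_trans)
  obtain b where b: "\<And>n. n \<ge> 2 \<Longrightarrow> poly p n + 2 \<le> n ^ b"
    using poly_le_power[of "p + [:2:]"] by auto
  define k where "k n = (SOME k. d n \<le> k * k \<and> k * k \<le> 3 * d n)" for n
  have k: "d n \<le> k n * k n" "k n * k n \<le> 3 * d n" for n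
    using someI_ex[OF exists_square_between[of "d n"]] by (simp_all add: k_def)
  define l where "l n = floorlog 2 (d n)" for n
  define S where "S n = (length (C n) * (d n + 1) + 1) ^ l n" for n
  define N where "N n = (d n + 2) ^ (length (C n) * formal_degree (C n))" for n
  define np where "np n = 1 + d n * S n ^ k n" for n
  define L where "L n = (length (C n) + 1) ^ k n" for n
  define e where "e n = (l n + 1) * (k n + 1)" for n
  note bounds = gate_bounds[OF C(3) d_le k(2) S_def np_def L_def, folded e_def]
  note four = depth_four_of_constant_free[OF C(1) d_eq k(1) S_def[unfolded l_def] N_def np_def L_def,
      unfolded C(2)]
  \<comment> \<open>Powers of \<open>poly p n + 2\<close> become powers of \<open>n\<close> at the
    price of the constant factor \<open>b\<close> in the exponent.\<close>
  have lift: "h n \<le> n ^ (b * c * x)" if "n \<ge> 2" "h n \<le> (poly p n + 2) ^ (c * x)" for h n c x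
  proof -
    have "h n \<le> (n ^ b) ^ (c * x)"
      using that b by (meson order_trans power_mono zero_le)
    then show ?thesis
      by (simp add: mult.assoc flip: power_mult)
  qed
  have fan_in: "real (k n + 1) \<le> sqrt (3 * d n) + 1" for n
  proof -
    have "real (k n) ^ 2 = real (k n * k n)"
      by (simp add: power2_eq_square)
    also have "\<dots> \<le> real (3 * d n)"
      using k(2) by (rule of_nat_mono)
    finally have "real (k n) \<le> sqrt (real (3 * d n))"
      by (rule real_le_rsqrt)
    then show ?thesis by simp
  qed
  have e_le: "real (e n) \<le> 9 * max 1 (sqrt (d n) * log 2 (d n))" for n
    unfolding e_def l_def by (rule sqrt_log_exponent[OF k(2)])
  obtain \<Gamma> where \<Gamma>: "\<And>n. depth_four_circuit (\<Gamma> n)" "\<And>n. circuit_poly (\<Gamma> n) = f n"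
      "\<And>n. num_add_gates (\<Gamma> n) \<le> 3 + (k n + 1) * S n ^ 2"
      "\<And>n. num_mul_gates (\<Gamma> n) \<le> (2 + (k n + 1) * S n ^ 2) * L n + np n"
      "\<And>n. mul_fan_in_le (\<Gamma> n) (real (k n + 1))" "\<And>n. depth_four_inputs (vars (f n)) (N n) (\<Gamma> n)"
    using four(1) by metis
  obtain F where F: "\<And>n. depth_four_formula (F n)" "\<And>n. circuit_poly (F n) = f n"
      "\<And>n. circuit_size (F n) \<le> np n * (k n + 1) * L n * (k n + 1) + np n * (k n + 1) * L n +
        np n * (k n + 1) + np n + 1"
      "\<And>n. mul_fan_in_le (F n) (real (k n + 1))" "\<And>n. depth_four_inputs (vars (f n)) (N n) (F n)"
    using four(2) by metis
  have add: "n_pow_O (\<lambda>n. num_add_gates (\<Gamma> n)) (\<lambda>n. log 2 (d n))"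
  proof (rule n_pow_OI)
    show "num_add_gates (\<Gamma> n) \<le> n ^ (b * 4 * (l n + 1))" if "n \<ge> 2" for n
      using that order_trans[OF \<Gamma>(3) bounds(1)] by (rule lift)
    show "real (l n + 1) \<le> 3 * max 1 (log 2 (d n))" for n
      unfolding l_def by (rule log_exponent)
  qed
  have mul: "n_pow_O (\<lambda>n. num_mul_gates (\<Gamma> n)) (\<lambda>n. sqrt (d n) * log 2 (d n))"
  proof (rule n_pow_OI[OF _ e_le])
    show "num_mul_gates (\<Gamma> n) \<le> n ^ (b * 6 * e n)" if "n \<ge> 2" for n
      using that order_trans[OF \<Gamma>(4) bounds(2)] by (rule lift)
  qed
  have size: "n_pow_O (\<lambda>n. circuit_size (F n)) (\<lambda>n. sqrt (d n) * log 2 (d n))"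
  proof (rule n_pow_OI[OF _ e_le])
    show "circuit_size (F n) \<le> n ^ (b * 10 * e n)" if "n \<ge> 2" for n
      using that order_trans[OF F(3) bounds(3)] by (rule lift)
  qed
  have inputs: "poly_size_inputs f \<Gamma>" "poly_size_inputs f F"
    using poly_size_inputsI[OF _ d_le C(3,4)] \<Gamma>(6) F(5) unfolding N_def by blast+
  have fan: "mul_fan_in_le (\<Gamma> n) (sqrt (3 * d n) + 1)" "mul_fan_in_le (F n) (sqrt (3 * d n) + 1)" for n
    using mul_fan_in_le_mono[OF _ fan_in] \<Gamma>(5) F(4) by blast+
  show ?thesis
    by (rule conjI[OF exI[of _ \<Gamma>] exI[of _ F]];
        intro conjI allI \<Gamma>(1,2) F(1,2) add mul size inputs fan)
qed

end
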